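(* Let $\tau$ vary in the upper half plane, set $\omega_1=1/2$, $\omega_3=\tau/2$, $\omega_2=-\omega_1-\omega_3$, let $e_i=\wp(\omega_i)$ $(i=1,2,3)$ and $\eta_1=\zeta(\omega_1)$ be formed from the Weierstrass functions with periods $(2\omega_1,2\omega_3)=(1,\tau)$, and set $g_2=-4(e_1e_2+e_2e_3+e_3e_1)$. Then, as functions of $\tau$, $$\frac{de_i}{d\tau}=\frac{-2\eta_1e_i+e_i^2-g_2/6}{\pi\sqrt{-1}}$$ for $i=1,2,3$.
   Context: For $\tau$ in the upper half plane, $\wp$ and $\zeta$ denote the Weierstrass $\wp$-function and Weierstrass zeta function of the lattice $\mathbb{Z}\oplus\tau\mathbb{Z}$ (with $\zeta'=-\wp$, $\zeta$ odd). Thus $e_1=\wp(1/2)$, $e_2=\wp((1+\tau)/2)$, $e_3=\wp(\tau/2)$ and $\eta_1=\zeta(1/2)$, all regarded as holomorphic functions of $\tau$. *)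

theory Defs
  imports "HOL-Analysis.Analysis"
begin

definition period_lattice :: "complex \<Rightarrow> complex set" where
  "period_lattice \<tau> = {of_int m + of_int n * \<tau> | m n. True}"

text \<open>
  The two series below converge absolutely whenever \<open>Im \<tau> \<noteq> 0\<close>. At a lattice point \<open>z\<close>, where the
  functions have a pole, division by zero gives a meaningless finite value.
\<close>

definition weierstrass_wp :: "complex \<Rightarrow> complex \<Rightarrow> complex" where
  "weierstrass_wp \<tau> z =
     1 / z\<^sup>2 + (\<Sum>\<^sub>\<infinity>w\<in>period_lattice \<tau> - {0}. 1 / (z - w)\<^sup>2 - 1 / w\<^sup>2)"

definition weierstrass_zeta :: "complex \<Rightarrow> complex \<Rightarrow> complex" where
  "weierstrass_zeta \<tau> z =
     1 / z + (\<Sum>\<^sub>\<infinity>w\<in>period_lattice \<tau> - {0}. 1 / (z - w) + 1 / w + z / w\<^sup>2)"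

text \<open>
  Half-periods, numbered so that the periods \<open>1\<close> and \<open>\<tau>\<close> are \<open>2\<omega>\<^sub>1\<close> and \<open>2\<omega>\<^sub>3\<close>, and
  \<open>\<omega>\<^sub>1 + \<omega>\<^sub>2 + \<omega>\<^sub>3 = 0\<close>. Only the indices 1, 2, 3 are meaningful.
\<close>

definition half_period :: "nat \<Rightarrow> complex \<Rightarrow> complex" where
  "half_period i \<tau> = (if i = 1 then 1 / 2 else if i = 3 then \<tau> / 2 else - (1 / 2) - \<tau> / 2)"

definition weierstrass_e :: "nat \<Rightarrow> complex \<Rightarrow> complex" where
  "weierstrass_e i \<tau> = weierstrass_wp \<tau> (half_period i \<tau>)"

definition weierstrass_eta1 :: "complex \<Rightarrow> complex" where
  "weierstrass_eta1 \<tau> = weierstrass_zeta \<tau> (half_period 1 \<tau>)"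

definition weierstrass_g2 :: "complex \<Rightarrow> complex" where
  "weierstrass_g2 \<tau> =
     - 4 * (weierstrass_e 1 \<tau> * weierstrass_e 2 \<tau> + weierstrass_e 2 \<tau> * weierstrass_e 3 \<tau>
            + weierstrass_e 3 \<tau> * weierstrass_e 1 \<tau>)"

end

theory Submission
  imports Defs "HOL-Complex_Analysis.Complex_Analysis"
begin

text \<open>
  Summing the lattice series over rows gives \<open>\<wp>(z) = P(z) - C\<close> and \<open>\<eta>\<^sub>1 = C / 2\<close>, where
  \<open>P(z) = \<Sum>\<^sub>n \<pi>\<^sup>2 / sin\<^sup>2 \<pi>(z - n\<tau>)\<close> and \<open>C\<close> is the Eisenstein series of weight two. Put
  \<open>Z(z) = \<Sum>\<^sub>n (\<pi> cot \<pi>(z - n\<tau>) - \<pi>\<i> sgn n)\<close> and \<open>Q(z) = \<Sum>\<^sub>n n \<pi>\<^sup>2 / sin\<^sup>2 \<pi>(z - n\<tau>)\<close>, so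
  that \<open>Z' = - P\<close> and \<open>\<partial>P/\<partial>\<tau> = - Q'\<close>. All of these have period 1, and under \<open>z \<mapsto> z + \<tau>\<close> the
  function \<open>Z\<close> changes by \<open>- 2\<pi>\<i>\<close> (this replaces Legendre's relation) and \<open>Q\<close> by \<open>P\<close>. Hence
  \<open>Z P' + 2\<pi>\<i> Q' + 2P\<^sup>2 - 6CP\<close> is elliptic; since \<open>Z(z) = 1/z - Cz + O(z\<^sup>3)\<close>, it has no pole at 0
  and is constant by Liouville's theorem.

  At a half period \<open>\<omega>\<^sub>i\<close> one has \<open>P'(\<omega>\<^sub>i) = 0\<close>, so the constancy expresses the \<open>\<tau>\<close>-derivative of
  \<open>P(\<omega>\<^sub>i)\<close> as a quadratic polynomial in \<open>P(\<omega>\<^sub>i)\<close> that does not depend on \<open>i\<close>. Its constant term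
  and the derivative of \<open>C\<close> are determined by \<open>e\<^sub>1 + e\<^sub>2 + e\<^sub>3 = 0\<close>, which follows from the duplication
  formula for \<open>1 / sin\<^sup>2\<close>.
\<close>

section \<open>Infinite sums and holomorphic functions\<close>

text \<open>On a closed disc inside \<open>U\<close> the Weierstrass M-test gives uniform
  convergence along the filter of finite subsets, and uniform limits of holomorphic functions may be
  differentiated term by term. The finite exceptional set \<open>N\<close> admits bounds that hold
  only once the index is large relative to \<open>K\<close>.\<close>

lemma has_sum_has_field_derivative_locally_dominated:
  fixes f :: "'a \<Rightarrow> complex \<Rightarrow> complex"
  assumes "open U" and z: "z \<in> U"
    and holo: "\<And>n. n \<in> A \<Longrightarrow> f n holomorphic_on U"
    and bound: "\<And>K. compact K \<Longrightarrow> K \<subseteq> U \<Longrightarrow>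
      \<exists>M N. finite N \<and> M summable_on A \<and> (\<forall>n\<in>A - N. \<forall>w\<in>K. norm (f n w) \<le> M n)"
  obtains D where "(\<lambda>n. f n z) summable_on A"
    and "((\<lambda>w. \<Sum>\<^sub>\<infinity>n\<in>A. f n w) has_field_derivative D) (at z)"
    and "((\<lambda>n. deriv (f n) z) has_sum D) A"
proof -
  obtain r where r: "r > 0" "cball z r \<subseteq> U"
    using assms(1) z open_contains_cball by blast
  obtain M N where MN: "finite N" "M summable_on A"
    "\<And>n w. n \<in> A - N \<Longrightarrow> w \<in> cball z r \<Longrightarrow> norm (f n w) \<le> M n"
    using bound[OF _ r(2)] by (metis compact_cball)
  have "\<exists>b. \<forall>w\<in>cball z r. norm (f n w) \<le> b" if "n \<in> A" for n
  proof -
    have "continuous_on (cball z r) (f n)"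
      using holo[OF that] r(2) holomorphic_on_imp_continuous_on continuous_on_subset by blast
    then have "bounded (f n ` cball z r)"
      by (intro compact_imp_bounded compact_continuous_image compact_cball)
    then show ?thesis by (auto simp: bounded_iff)
  qed
  then obtain b where b: "\<And>n w. n \<in> A \<Longrightarrow> w \<in> cball z r \<Longrightarrow> norm (f n w) \<le> b n"
    by metis
  \<comment> \<open>On the exceptional indices the majorant becomes the maximum bound
    \<open>b n\<close> on the disc; changing finitely many terms keeps it summable.\<close>
  define M' where "M' n = (if n \<in> N then b n - M n else 0) + M n" for n
  have "M' summable_on A"
    unfolding M'_def
    by (intro summable_on_add MN(2) finite_nonzero_values_imp_summable_on)
       (rule finite_subset[OF _ MN(1)], auto)
  moreover have M': "norm (f n w) \<le> M' n" if "n \<in> A" "w \<in> cball z r" for n w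
    using b[OF that] MN(3)[of n w] that by (auto simp: M'_def)
  ultimately have ul: "uniform_limit (cball z r) (\<lambda>X w. \<Sum>n\<in>X. f n w)
      (\<lambda>w. \<Sum>\<^sub>\<infinity>n\<in>A. f n w) (finite_subsets_at_top A)"
    by (intro Weierstrass_m_test_general)
  have summ: "(\<lambda>n. f n z) summable_on A"
    using r(1)
    by (intro abs_summable_summable[OF Infinite_Sum.abs_summable_on_comparison_test'[OF \<open>M' summable_on A\<close>]] M') auto
  have ev: "\<forall>\<^sub>F X in finite_subsets_at_top A. continuous_on (cball z r) (\<lambda>w. \<Sum>n\<in>X. f n w) \<and>
      (\<forall>w\<in>ball z r. ((\<lambda>w. \<Sum>n\<in>X. f n w) has_field_derivative (\<Sum>n\<in>X. deriv (f n) w)) (at w))"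
    unfolding eventually_finite_subsets_at_top
  proof (intro exI[of _ "{}"] conjI allI impI ballI; (elim conjE)?)
    fix X assume X: "finite X" "X \<subseteq> A"
    show "continuous_on (cball z r) (\<lambda>w. \<Sum>n\<in>X. f n w)"
      using X r(2) holo
      by (intro continuous_on_sum) (meson continuous_on_subset holomorphic_on_imp_continuous_on subsetD)
  next
    fix X w assume X: "finite X" "X \<subseteq> A" and w: "w \<in> ball z r"
    then have "w \<in> U" using r(2) by auto
    then show "((\<lambda>w. \<Sum>n\<in>X. f n w) has_field_derivative (\<Sum>n\<in>X. deriv (f n) w)) (at w)"
      using X holo assms(1) by (intro DERIV_sum) (auto intro: holomorphic_derivI)
  qed auto
  obtain g' where g': "\<And>w. w \<in> ball z r \<Longrightarrow>
      ((\<lambda>w. \<Sum>\<^sub>\<infinity>n\<in>A. f n w) has_field_derivative g' w) (at w) \<and>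
      ((\<lambda>X. \<Sum>n\<in>X. deriv (f n) w) \<longlongrightarrow> g' w) (finite_subsets_at_top A)"
    using has_complex_derivative_uniform_limit[OF ev ul finite_subsets_at_top_neq_bot r(1)]
    by blast
  show ?thesis
    by (rule that[OF summ, of "g' z"]) (use g'[of z] r(1) in \<open>auto simp: has_sum_def\<close>)
qed

lemma summable_on_int_if_summable_abs:
  fixes g :: "nat \<Rightarrow> real"
  assumes "summable g" "\<And>n. g n \<ge> 0"
  shows "(\<lambda>n::int. g (nat \<bar>n\<bar>)) summable_on A"
proof -
  have *: "(\<lambda>n::int. g (nat \<bar>n\<bar>)) summable_on range h"
    if "inj h" "\<And>k. nat \<bar>h k\<bar> = k" for h :: "nat \<Rightarrow> int"
    using assms that by (subst summable_on_reindex) (auto simp: o_def summable_on_UNIV_nonneg_real_iff)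
  have "n \<in> range int \<union> range (\<lambda>k. - int k)" for n :: int
    by (cases n rule: int_cases2) auto
  then have U: "(UNIV :: int set) = range int \<union> range (\<lambda>k. - int k)" by blast
  have "(\<lambda>n::int. g (nat \<bar>n\<bar>)) summable_on UNIV"
    unfolding U by (intro summable_on_union *) (auto simp: inj_def)
  then show ?thesis using summable_on_subset by blast
qed

lemma infsum_int_shift:
  fixes f :: "int \<Rightarrow> 'a::{topological_comm_monoid_add,t2_space}"
  shows "(\<Sum>\<^sub>\<infinity>n. f (n + k)) = (\<Sum>\<^sub>\<infinity>n. f n)"
  by (rule infsum_reindex_bij_witness[of _ "\<lambda>n. n - k" "\<lambda>n. n + k"]) auto

lemma infsum_int_minus:
  fixes f :: "int \<Rightarrow> 'a::{topological_comm_monoid_add,t2_space}"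
  shows "(\<Sum>\<^sub>\<infinity>n. f (- n)) = (\<Sum>\<^sub>\<infinity>n. f n)"
  by (rule infsum_reindex_bij_witness[of _ "\<lambda>n. - n" "\<lambda>n. - n"]) auto

lemma tendsto_symmetric_sum_infsum_int:
  fixes f :: "int \<Rightarrow> 'a::{topological_comm_monoid_add,t2_space}"
  assumes "f summable_on UNIV"
  shows "(\<lambda>N. \<Sum>n=-int N..int N. f n) \<longlonglongrightarrow> (\<Sum>\<^sub>\<infinity>n. f n)"
proof -
  have "filterlim (\<lambda>N. {-int N..int N}) (finite_subsets_at_top UNIV) sequentially"
    unfolding filterlim_finite_subsets_at_top
  proof (intro allI impI, elim conjE)
    fix X :: "int set" assume X: "finite X"
    define m where "m = nat (Max (insert 0 (abs ` X)))"
    have m: "\<bar>x\<bar> \<le> int m" if "x \<in> X" for x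
      using X that Max_ge[of "insert 0 (abs ` X)" "\<bar>x\<bar>"] by (simp add: m_def)
    show "\<forall>\<^sub>F N in sequentially. finite {- int N..int N} \<and> X \<subseteq> {- int N..int N} \<and> {- int N..int N} \<subseteq> UNIV"
      using eventually_ge_at_top[of m]
    proof eventually_elim
      case (elim N)
      then show ?case using m by force
    qed
  qed
  then show ?thesis
    using infsum_tendsto[OF assms] filterlim_compose by blast
qed

text \<open>The sum over \<open>{- N..N}\<close> collapses to \<open>v N - v (- N - 1)\<close>. This
  evaluates the part of the zeta series that telescopes along a row of the lattice.\<close>

lemma infsum_int_telescope:
  fixes v :: "int \<Rightarrow> complex"
  assumes s: "(\<lambda>m. v m - v (m - 1)) summable_on UNIV"
    and "(\<lambda>N. v (int N)) \<longlonglongrightarrow> 0" "(\<lambda>N. v (- int N)) \<longlonglongrightarrow> 0"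
  shows "(\<Sum>\<^sub>\<infinity>m. v m - v (m - 1)) = 0"
proof -
  have tel: "(\<Sum>m=-int N..int N. v m - v (m - 1)) = v (int N) - v (- int (Suc N))" for N
  proof (induction N)
    case (Suc N)
    have "{- int (Suc N)..int (Suc N)} = insert (- int (Suc N)) (insert (int (Suc N)) {- int N..int N})"
      by auto
    with Suc show ?case by (simp add: algebra_simps)
  qed simp
  have "(\<lambda>N. v (int N) - v (- int (Suc N))) \<longlonglongrightarrow> 0 - 0"
    using assms(2) LIMSEQ_Suc[OF assms(3)] by (rule tendsto_diff)
  with tendsto_symmetric_sum_infsum_int[OF s] show ?thesis
    unfolding tel using LIMSEQ_unique by fastforce
qed

section \<open>Lattice sums\<close>

lemma summable_on_int_nat_times_exp:
  assumes "b > 0"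
  shows "(\<lambda>n::int. (1 + \<bar>real_of_int n\<bar>) * exp (- b * \<bar>real_of_int n\<bar>)) summable_on A"
proof -
  have "exp (- b) < 1" using assms by simp
  then have "(\<lambda>n. of_nat (Suc n) * exp (- b) ^ n) sums (1 / (1 - exp (- b))\<^sup>2)"
    by (intro geometric_deriv_sums) auto
  then have "summable (\<lambda>n. (1 + real n) * exp (- b * real n))"
    by (simp add: sums_iff exp_of_nat_mult[symmetric] mult.commute)
  from summable_on_int_if_summable_abs[OF this, of A] show ?thesis by simp
qed

text \<open>The imaginary part of the number controls \<open>y\<close>; given \<open>y\<close>, the
  real part controls \<open>x\<close>. Adding the two estimates produces the constant
  \<open>k\<close>. All later lattice estimates rest on this comparison with the l1 norm of the
  coordinates.\<close>

lemma cmod_real_plus_real_times_ge: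
  assumes "Im \<tau> > 0"
  obtains k where "k > 0" "\<And>x y. cmod (of_real x + of_real y * \<tau>) \<ge> k * (\<bar>x\<bar> + \<bar>y\<bar>)"
proof -
  define k where "k = Im \<tau> / (1 + Im \<tau> + \<bar>Re \<tau>\<bar>)"
  have "k > 0" unfolding k_def using assms by (intro divide_pos_pos) auto
  moreover have "k * (\<bar>x\<bar> + \<bar>y\<bar>) \<le> cmod (of_real x + of_real y * \<tau>)" for x y
  proof -
    let ?w = "of_real x + of_real y * \<tau>"
    have y: "\<bar>y\<bar> * Im \<tau> \<le> cmod ?w"
      using abs_Im_le_cmod[of ?w] assms by (simp add: abs_mult)
    have "\<bar>x\<bar> \<le> \<bar>x + y * Re \<tau>\<bar> + \<bar>y\<bar> * \<bar>Re \<tau>\<bar>"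
      using abs_triangle_ineq4[of "x + y * Re \<tau>" "y * Re \<tau>"] by (simp add: abs_mult)
    also have "\<bar>x + y * Re \<tau>\<bar> \<le> cmod ?w" using abs_Re_le_cmod[of ?w] by simp
    finally have x: "\<bar>x\<bar> * Im \<tau> \<le> (cmod ?w + \<bar>y\<bar> * \<bar>Re \<tau>\<bar>) * Im \<tau>"
      using assms by (intro mult_right_mono) auto
    have "\<bar>y\<bar> * Im \<tau> * \<bar>Re \<tau>\<bar> \<le> cmod ?w * \<bar>Re \<tau>\<bar>" using y by (intro mult_right_mono) auto
    with x y have "Im \<tau> * (\<bar>x\<bar> + \<bar>y\<bar>) \<le> cmod ?w * (1 + Im \<tau> + \<bar>Re \<tau>\<bar>)"
      by (simp add: algebra_simps)
    then show ?thesis unfolding k_def using assms by (simp add: field_simps add_pos_nonneg)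
  qed
  ultimately show ?thesis using that by blast
qed

text \<open>Each of \<open>1 + \<bar>n\<bar>\<close> and \<open>1 + \<bar>m\<bar>\<close> is at most
  twice the l1 norm \<open>r\<close> off the origin, so \<open>1 / r ^ 3\<close> is at most 8 times
  a product of two terms of exponent -3/2. That product is summable one variable at a time. At the
  origin the term is 0 by division by zero.\<close>

lemma summable_on_inverse_cube_l1:
  "(\<lambda>(n::int, m::int). 1 / (\<bar>real_of_int m\<bar> + \<bar>real_of_int n\<bar>) ^ 3) summable_on UNIV"
proof -
  define a :: "int \<Rightarrow> real" where "a n = (1 + \<bar>real_of_int n\<bar>) powr (-3/2)" for n
  have "summable (\<lambda>n. real (Suc n) powr (-3/2))"
    by (subst summable_Suc_iff) (simp add: summable_real_powr_iff)
  from summable_on_int_if_summable_abs[OF this, of UNIV] have a: "a summable_on UNIV"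
    by (simp add: a_def[abs_def] add.commute)
  have S: "(\<lambda>(n, m). 8 * (a n * a m)) summable_on (UNIV \<times> UNIV)"
  proof (rule summable_on_SigmaI)
    show "((\<lambda>m. case (n, m) of (n, m) \<Rightarrow> 8 * (a n * a m)) has_sum 8 * (a n * infsum a UNIV)) UNIV" for n
      using a by (auto intro!: has_sum_cmult_right)
    show "(\<lambda>n. 8 * (a n * infsum a UNIV)) summable_on UNIV"
      using a by (intro summable_on_cmult_right summable_on_cmult_left)
  qed (auto simp: a_def)
  have N: "norm (1 / (\<bar>real_of_int m\<bar> + \<bar>real_of_int n\<bar>) ^ 3) \<le> 8 * (a n * a m)" for n m :: int
  proof (cases "n = 0 \<and> m = 0")
    case False
    define r where "r = \<bar>real_of_int m\<bar> + \<bar>real_of_int n\<bar>"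
    have r: "r \<ge> 1" using False unfolding r_def by linarith
    have "(1 + \<bar>real_of_int n\<bar>) * (1 + \<bar>real_of_int m\<bar>) \<le> (2 * r) * (2 * r)"
      using r unfolding r_def by (intro mult_mono) auto
    also have "\<dots> = (2 * r) powr 2" using r by (simp add: powr_numeral power2_eq_square)
    finally have "((2 * r) powr 2) powr (-3/2) \<le>
        ((1 + \<bar>real_of_int n\<bar>) * (1 + \<bar>real_of_int m\<bar>)) powr (-3/2)"
      by (intro powr_mono2') (auto intro!: mult_pos_pos)
    also have "\<dots> = a n * a m" by (simp add: a_def powr_mult)
    also have "((2 * r) powr 2) powr (-3/2) = 1 / (2 * r) ^ 3"
      unfolding powr_powr using r by (simp add: powr_minus_divide powr_numeral)
    finally show ?thesis using r by (simp add: r_def[symmetric] field_simps)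
  qed (simp add: a_def)
  have "(\<lambda>p. norm ((\<lambda>(n, m). 1 / (\<bar>real_of_int m\<bar> + \<bar>real_of_int n\<bar>) ^ 3) p)) summable_on UNIV \<times> UNIV"
    by (rule Infinite_Sum.abs_summable_on_comparison_test'[OF S]) (use N in auto)
  then show ?thesis unfolding UNIV_Times_UNIV by (rule abs_summable_summable)
qed

text \<open>Cubic decay gives absolute convergence, so Fubini allows summation row by row, with
  \<open>n\<close> numbering the row and \<open>m\<close> running along it. The origin is free of
  the bound, so \<open>f 0\<close> can later be the term of a Weierstrass series that stands outside
  the sum.\<close>

lemma
  fixes f :: "complex \<Rightarrow> complex"
  assumes \<tau>: "Im \<tau> > 0"
    and bound: "\<And>x y. (x, y) \<noteq> (0, 0) \<Longrightarrow>
      norm (f (of_int x + of_int y * \<tau>)) \<le> K / (\<bar>real_of_int x\<bar> + \<bar>real_of_int y\<bar>) ^ 3"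
  shows summable_on_period_lattice: "(\<lambda>(n::int, m::int). f (of_int m + of_int n * \<tau>)) summable_on UNIV \<times> UNIV"
    and infsum_period_lattice: "f 0 + (\<Sum>\<^sub>\<infinity>w\<in>period_lattice \<tau> - {0}. f w) =
           (\<Sum>\<^sub>\<infinity>n::int. \<Sum>\<^sub>\<infinity>m::int. f (of_int m + of_int n * \<tau>))"
proof -
  define h where "h = (\<lambda>(n::int, m::int). of_int m + of_int n * \<tau>)"
  obtain k where k: "k > 0" "\<And>x y. cmod (of_real x + of_real y * \<tau>) \<ge> k * (\<bar>x\<bar> + \<bar>y\<bar>)"
    using cmod_real_plus_real_times_ge[OF \<tau>] by blast
  have h0: "m = 0 \<and> n = 0" if "h (n, m) = 0" for n m
  proof -
    have "k * (\<bar>real_of_int m\<bar> + \<bar>real_of_int n\<bar>) \<le> 0"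
      using k(2)[of "of_int m" "of_int n"] that by (simp add: h_def)
    then have "\<bar>real_of_int m\<bar> + \<bar>real_of_int n\<bar> \<le> 0" using k(1) by (simp add: mult_le_0_iff)
    then show ?thesis by linarith
  qed
  \<comment> \<open>Equal images mean that the difference of the index pairs is mapped to 0, hence
    is 0.\<close>
  have "inj h"
  proof (rule injI)
    fix p q assume "h p = h q"
    then show "p = q"
      using h0[of "fst p - fst q" "snd p - snd q"]
      by (auto simp: h_def algebra_simps split: prod.splits)
  qed
  define g where "g p = (if p = (0, 0) then norm (f 0) else 0) +
    K * (case p of (n, m) \<Rightarrow> 1 / (\<bar>real_of_int m\<bar> + \<bar>real_of_int n\<bar>) ^ 3)" for p :: "int \<times> int"
  have "g summable_on UNIV"
    unfolding g_def
    by (intro summable_on_add summable_on_cmult_right summable_on_inverse_cube_l1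
          finite_nonzero_values_imp_summable_on) auto
  moreover have "norm (f (h p)) \<le> g p" for p
    using bound[of "snd p" "fst p"] by (cases p) (auto simp: g_def h_def)
  ultimately have summ: "(\<lambda>p. f (h p)) summable_on UNIV"
    by (rule abs_summable_summable[OF Infinite_Sum.abs_summable_on_comparison_test'])
  then show "(\<lambda>(n, m). f (of_int m + of_int n * \<tau>)) summable_on UNIV \<times> UNIV"
    unfolding h_def by (simp add: case_prod_unfold)
  have img: "h ` (UNIV - {(0, 0)}) = period_lattice \<tau> - {0}"
  proof (intro equalityI subsetI)
    fix w assume "w \<in> period_lattice \<tau> - {0}"
    then obtain m n where "w = h (n, m)" "w \<noteq> 0"
      by (auto simp: period_lattice_def h_def)
    moreover from this have "(n, m) \<noteq> (0, 0)" by (auto simp: h_def)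
    ultimately show "w \<in> h ` (UNIV - {(0, 0)})" by blast
  next
    fix w assume "w \<in> h ` (UNIV - {(0, 0)})"
    then obtain n m where nm: "w = h (n, m)" "(n, m) \<noteq> (0, 0)" by auto
    then have "w \<noteq> 0" using h0[of n m] by auto
    moreover have "w \<in> period_lattice \<tau>"
      unfolding nm(1) h_def period_lattice_def by auto
    ultimately show "w \<in> period_lattice \<tau> - {0}" by blast
  qed
  have "(\<Sum>\<^sub>\<infinity>w\<in>period_lattice \<tau> - {0}. f w) = (\<Sum>\<^sub>\<infinity>p\<in>UNIV - {(0, 0)}. f (h p))"
    unfolding img[symmetric]
    by (subst infsum_reindex) (use \<open>inj h\<close> in \<open>auto simp: o_def intro: inj_on_subset\<close>)
  moreover have "(\<Sum>\<^sub>\<infinity>p\<in>insert (0, 0) (UNIV - {(0, 0)}). f (h p)) =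
      f (h (0, 0)) + (\<Sum>\<^sub>\<infinity>p\<in>UNIV - {(0, 0)}. f (h p))"
    by (intro infsum_insert summable_on_subset[OF summ]) auto
  moreover have "(\<Sum>\<^sub>\<infinity>n. \<Sum>\<^sub>\<infinity>m. f (h (n, m))) = (\<Sum>\<^sub>\<infinity>p\<in>UNIV \<times> UNIV. f (h p))"
    by (rule infsum_Sigma_banach) (use summ in auto)
  ultimately show "f 0 + (\<Sum>\<^sub>\<infinity>w\<in>period_lattice \<tau> - {0}. f w) =
      (\<Sum>\<^sub>\<infinity>n. \<Sum>\<^sub>\<infinity>m. f (of_int m + of_int n * \<tau>))"
    by (simp add: h_def insert_UNIV)
qed

section \<open>Elliptic functions\<close>

text \<open>Distinct lattice points have coordinates at l1 distance at least 1, hence lie at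
  distance at least \<open>k\<close> from each other.\<close>

lemma closed_period_lattice:
  assumes "Im \<tau> > 0"
  shows "closed (period_lattice \<tau>)"
proof -
  obtain k where k: "k > 0" "\<And>x y. cmod (of_real x + of_real y * \<tau>) \<ge> k * (\<bar>x\<bar> + \<bar>y\<bar>)"
    using cmod_real_plus_real_times_ge[OF assms] by blast
  show ?thesis
  proof (rule discrete_imp_closed[OF k(1)], intro ballI impI)
    fix x y assume "x \<in> period_lattice \<tau>" "y \<in> period_lattice \<tau>" and d: "dist y x < k"
    then obtain a b c d where ab: "x = of_int a + of_int b * \<tau>" "y = of_int c + of_int d * \<tau>"
      by (auto simp: period_lattice_def)
    have "k * (\<bar>real_of_int (c - a)\<bar> + \<bar>real_of_int (d - b)\<bar>) \<le> dist y x"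
      using k(2)[of "of_int (c - a)" "of_int (d - b)"] by (simp add: ab dist_norm algebra_simps)
    also have "\<dots> < k * 1" using d by simp
    finally have "\<bar>real_of_int (c - a)\<bar> + \<bar>real_of_int (d - b)\<bar> < 1" using k(1) by simp
    then have "\<bar>c - a\<bar> + \<bar>d - b\<bar> < 1" by linarith
    then have "c = a \<and> d = b" by linarith
    then show "y = x" by (simp add: ab)
  qed
qed

lemma zero_in_period_lattice: "0 \<in> period_lattice \<tau>"
  and one_in_period_lattice: "1 \<in> period_lattice \<tau>"
  and tau_in_period_lattice: "\<tau> \<in> period_lattice \<tau>"
  unfolding period_lattice_def mem_Collect_eq
  by (rule exI[of _ 1] exI[of _ 0], rule exI[of _ 0] exI[of _ 1], simp)+

lemma
  assumes "w \<in> period_lattice \<tau>"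
  shows period_lattice_diff_iff: "z - w \<in> period_lattice \<tau> \<longleftrightarrow> z \<in> period_lattice \<tau>"
    and period_lattice_add_iff: "z + w \<in> period_lattice \<tau> \<longleftrightarrow> z \<in> period_lattice \<tau>"
proof -
  have m: "u - w \<in> period_lattice \<tau>" and p: "u + w \<in> period_lattice \<tau>"
    if "u \<in> period_lattice \<tau>" for u
  proof -
    obtain a b where w: "w = of_int a + of_int b * \<tau>"
      using assms by (auto simp: period_lattice_def)
    obtain c d where u: "u = of_int c + of_int d * \<tau>"
      using \<open>u \<in> period_lattice \<tau>\<close> by (auto simp: period_lattice_def)
    have "u - w = of_int (c - a) + of_int (d - b) * \<tau>" "u + w = of_int (c + a) + of_int (d + b) * \<tau>"
      by (simp_all add: u w algebra_simps)
    then show "u - w \<in> period_lattice \<tau>" "u + w \<in> period_lattice \<tau>"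
      unfolding period_lattice_def by blast+
  qed
  show "z - w \<in> period_lattice \<tau> \<longleftrightarrow> z \<in> period_lattice \<tau>" using m[of z] p[of "z - w"] by auto
  show "z + w \<in> period_lattice \<tau> \<longleftrightarrow> z \<in> period_lattice \<tau>" using p[of z] m[of "z + w"] by auto
qed

text \<open>\<open>F\<close> is extended over the lattice by the value \<open>g 0\<close>. By
  periodicity, \<open>g\<close> removes the singularity at every lattice point and not only at 0, so
  the extension is entire; it takes all its values on a compact period parallelogram, and
  Liouville's theorem applies.\<close>

lemma elliptic_function_without_poles_constant:
  assumes \<tau>: "Im \<tau> > 0"
    and holo: "F holomorphic_on - period_lattice \<tau>"
    and p1: "\<And>z. z \<notin> period_lattice \<tau> \<Longrightarrow> F (z + 1) = F z"
    and p\<tau>: "\<And>z. z \<notin> period_lattice \<tau> \<Longrightarrow> F (z + \<tau>) = F z"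
    and r: "r > 0" "ball 0 r \<inter> period_lattice \<tau> \<subseteq> {0}"
    and g: "g holomorphic_on ball 0 r" "\<And>z. z \<in> ball 0 r \<Longrightarrow> z \<noteq> 0 \<Longrightarrow> F z = g z"
  obtains c where "\<And>z. z \<notin> period_lattice \<tau> \<Longrightarrow> F z = c"
proof -
  define L where "L = period_lattice \<tau>"
  define H where "H z = (if z \<in> L then g 0 else F z)" for z
  note add = period_lattice_add_iff[where \<tau> = \<tau>, folded L_def]
    and basis = one_in_period_lattice[of \<tau>, folded L_def] tau_in_period_lattice[of \<tau>, folded L_def]
      zero_in_period_lattice[of \<tau>, folded L_def]
  have H1: "H (z + 1) = H z" and H\<tau>: "H (z + \<tau>) = H z" for z
    using p1 p\<tau> add[OF basis(1)] add[OF basis(2)] by (auto simp: H_def L_def)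
  have H1n: "H (z + of_int n) = H z" for z n
  proof (induction n rule: int_induct[where k = 0])
    case (step1 i) then show ?case using H1[of "z + of_int i"] by (simp add: add_ac)
  next
    case (step2 i) then show ?case using H1[of "z + of_int (i - 1)"] by (simp add: algebra_simps)
  qed simp
  have H\<tau>n: "H (z + of_int n * \<tau>) = H z" for z n
  proof (induction n rule: int_induct[where k = 0])
    case (step1 i) then show ?case using H\<tau>[of "z + of_int i * \<tau>"] by (simp add: algebra_simps)
  next
    case (step2 i) then show ?case using H\<tau>[of "z + of_int (i - 1) * \<tau>"] by (simp add: algebra_simps)
  qed simp
  have Hw: "H (z - w) = H z" if "w \<in> L" for z w
  proof -
    obtain a b where w: "w = of_int a + of_int b * \<tau>"
      using \<open>w \<in> L\<close> by (auto simp: L_def period_lattice_def)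
    show ?thesis
      using H1n[of "z - w" a] H\<tau>n[of "z - w + of_int a" b] by (simp add: w)
  qed
  have "H field_differentiable at z" for z
  proof (cases "z \<in> L")
    case False
    have op: "open (- L)" using closed_period_lattice[OF \<tau>] by (auto simp: L_def)
    then have "F field_differentiable at z"
      using holo False by (auto simp: L_def holomorphic_on_open field_differentiable_def)
    then show ?thesis
      unfolding field_differentiable_def
      by (elim exE) (rule exI, erule has_field_derivative_transform_within_open[OF _ op], use False in \<open>auto simp: H_def\<close>)
  next
    case True
    have eq: "H u = g (u - z)" if "u \<in> ball z r" for u
    proof -
      have b: "u - z \<in> ball 0 r" using that by (auto simp: dist_norm norm_minus_commute)
      have "H u = H (u - z)" using Hw[OF True] by simp
      also have "\<dots> = g (u - z)"
        using b r(2) g(2) basis(3) by (cases "u - z = 0") (auto simp: H_def L_def)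
      finally show ?thesis .
    qed
    have "(g has_field_derivative deriv g 0) (at (z - z))"
      using g(1) r(1) by (auto intro!: holomorphic_derivI)
    then have "((\<lambda>u. g (u - z)) has_field_derivative deriv g 0 * 1) (at z)"
      by (intro DERIV_chain2[where f = g]) (auto intro!: derivative_eq_intros)
    then show ?thesis
      unfolding field_differentiable_def
      by (intro exI) (erule has_field_derivative_transform_within_open[of _ _ _ "ball z r"], use r(1) eq in auto)
  qed
  then have Hholo: "H holomorphic_on UNIV"
    by (simp add: holomorphic_on_def)
  \<comment> \<open>The closed period parallelogram: fractional parts of the two real coordinates
    move any point into it.\<close>
  define K where "K = (\<lambda>(x, y). of_real x + of_real y * \<tau>) ` ({0..1} \<times> {0..1::real})"
  have "compact K"
    unfolding K_def case_prod_unfold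
    by (intro compact_continuous_image compact_Times continuous_intros compact_Icc)
  then have "compact (H ` K)"
    using Hholo holomorphic_on_imp_continuous_on continuous_on_subset
    by (metis compact_continuous_image subset_UNIV)
  moreover have "range H \<subseteq> H ` K"
  proof safe
    fix z
    define y where "y = Im z / Im \<tau>"
    define x where "x = Re z - y * Re \<tau>"
    have z: "z = of_real x + of_real y * \<tau>"
      using \<tau> by (simp add: complex_eq_iff x_def y_def)
    define u where "u = of_real (frac x) + of_real (frac y) * \<tau>"
    have "u \<in> K"
      unfolding K_def u_def
      by (rule image_eqI[of _ _ "(frac x, frac y)"]) (auto simp: frac_lt_1 less_imp_le)
    moreover have "z = u + of_int \<lfloor>x\<rfloor> + of_int \<lfloor>y\<rfloor> * \<tau>"
      unfolding z u_def frac_def by (simp add: algebra_simps)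
    then have "H z = H u" by (simp add: H1n H\<tau>n)
    ultimately show "H z \<in> H ` K" by auto
  qed
  ultimately have "bounded (range H)" by (meson bounded_subset compact_imp_bounded)
  with Hholo have "H constant_on UNIV" by (rule Liouville_theorem)
  then obtain c where "\<And>z. H z = c" by (auto simp: constant_on_def)
  then show ?thesis by (metis H_def L_def that)
qed

section \<open>The functions \<open>\<pi> cot \<pi>u\<close> and \<open>\<pi>\<^sup>2 / sin\<^sup>2 \<pi>u\<close>\<close>

definition cot_pi :: "complex \<Rightarrow> complex" where
  "cot_pi u = of_real pi * cot (of_real pi * u)"

text \<open>This is the sum of \<open>1 / (u - m)\<^sup>2\<close> over all integers
  \<open>m\<close>, the contribution of one lattice row; minus its primitive is
  \<open>cot_pi\<close>.\<close>

definition csc2_pi :: "complex \<Rightarrow> complex" where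
  "csc2_pi u = (of_real pi / sin (of_real pi * u))\<^sup>2"

lemma sin_pi_times_eq_0_iff: "sin (of_real pi * u) = 0 \<longleftrightarrow> u \<in> \<int>" for u :: complex
proof -
  have "sin (of_real pi * u) = 0 \<longleftrightarrow> (\<exists>n::int. of_real pi * u = of_real pi * of_int n)"
    by (simp add: sin_eq_0 mult.commute)
  then show ?thesis by (auto simp: Ints_def)
qed

lemma cot_pi_minus: "cot_pi (- u) = - cot_pi u"
  and csc2_pi_minus: "csc2_pi (- u) = csc2_pi u"
  by (auto simp: cot_pi_def csc2_pi_def cot_def)

lemma cot_pi_plus_1: "cot_pi (u + 1) = cot_pi u"
  and csc2_pi_plus_1: "csc2_pi (u + 1) = csc2_pi u"
  by (auto simp: cot_pi_def csc2_pi_def cot_def sin_add cos_add distrib_left sin_of_real cos_of_real)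

lemma has_field_derivative_cot_pi:
  assumes "u \<notin> \<int>"
  shows "(cot_pi has_field_derivative - csc2_pi u) (at u)"
proof -
  have "sin (of_real pi * u) \<noteq> 0" using assms by (simp add: sin_pi_times_eq_0_iff)
  then have "((\<lambda>u. cot (of_real pi * u)) has_field_derivative
      - inverse ((sin (of_real pi * u))\<^sup>2) * of_real pi) (at u)"
    by (intro DERIV_chain2[OF DERIV_cot]) (auto intro!: derivative_eq_intros)
  from DERIV_cmult[OF this, of "of_real pi"] show ?thesis
    unfolding cot_pi_def[abs_def] csc2_pi_def by (simp add: power2_eq_square field_simps)
qed

lemma holomorphic_on_cot_pi:
  assumes "g holomorphic_on U" "\<And>z. z \<in> U \<Longrightarrow> g z \<notin> \<int>"
  shows "(\<lambda>z. cot_pi (g z)) holomorphic_on U"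
  using assms unfolding cot_pi_def cot_def
  by (intro holomorphic_intros) (auto simp: sin_pi_times_eq_0_iff)

lemma holomorphic_on_csc2_pi:
  assumes "g holomorphic_on U" "\<And>z. z \<in> U \<Longrightarrow> g z \<notin> \<int>"
  shows "(\<lambda>z. csc2_pi (g z)) holomorphic_on U"
  using assms unfolding csc2_pi_def
  by (intro holomorphic_intros) (auto simp: sin_pi_times_eq_0_iff)

text \<open>The shift by 1/2 turns the sine into a cosine, and 1/s^2 + 1/c^2 = 1/(s c)^2 = 4/(2 s
  c)^2 for s^2 + c^2 = 1.\<close>

lemma csc2_pi_duplication:
  assumes "2 * u \<notin> \<int>"
  shows "csc2_pi u + csc2_pi (u + 1 / 2) = 4 * csc2_pi (2 * u)"
proof -
  let ?v = "of_real pi * u :: complex"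
  have "sin (2 * ?v) \<noteq> 0"
    using assms sin_pi_times_eq_0_iff[of "2 * u"] by (simp add: mult_ac)
  then have nz: "sin ?v \<noteq> 0" "cos ?v \<noteq> 0" by (auto simp: sin_double)
  have "sin (of_real pi * (u + 1 / 2)) = cos ?v"
    using sin_cos_eq[of "of_real pi * (u + 1 / 2)"] cos_minus[of ?v]
    by (simp add: distrib_left)
  moreover have "sin (of_real pi * (2 * u)) = 2 * sin ?v * cos ?v"
    using sin_double[of ?v] by (simp add: mult_ac)
  ultimately show ?thesis
    using nz by (simp add: csc2_pi_def field_simps) (simp flip: distrib_left)
qed

text \<open>The two exponentials in 2 sin v have moduli exp(Im v) and exp(- Im v). For \<bar>Im
  v\<bar> at least 1 the larger is at least twice the smaller, so their difference retains half of
  the larger.\<close>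

lemma norm_sin_ge:
  assumes "\<bar>Im v\<bar> \<ge> 1"
  shows "norm (sin v) \<ge> exp \<bar>Im v\<bar> / 4"
proof -
  have "\<bar>exp (- Im v) - exp (Im v)\<bar> = \<bar>norm (exp (\<i> * v)) - norm (exp (- (\<i> * v)))\<bar>"
    by simp
  also have "\<dots> \<le> norm (exp (\<i> * v) - exp (- (\<i> * v)))" by (rule norm_triangle_ineq3)
  also have "\<dots> = 2 * norm (sin v)" by (simp add: sin_exp_eq norm_divide norm_mult)
  finally have 1: "\<bar>exp (- Im v) - exp (Im v)\<bar> \<le> 2 * norm (sin v)" .
  have e: "exp y \<ge> 2 * exp (- y)" if "y \<ge> 1" for y :: real
  proof -
    have "2 \<le> exp (2 * y)" using exp_ge_add_one_self[of "2 * y"] that by linarith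
    then have "exp (- y) * 2 \<le> exp (- y) * exp (2 * y)" by (intro mult_left_mono) auto
    then show ?thesis by (simp add: exp_add[symmetric])
  qed
  show ?thesis
    using 1 e[of "\<bar>Im v\<bar>"] assms by (cases "Im v \<ge> 0") (auto simp: abs_if split: if_splits)
qed

lemma norm_csc2_pi_le:
  assumes "\<bar>Im u\<bar> \<ge> 1"
  shows "norm (csc2_pi u) \<le> 16 * pi\<^sup>2 * exp (- \<bar>Im u\<bar>)"
proof -
  let ?v = "of_real pi * u"
  have Im: "\<bar>Im u\<bar> \<le> \<bar>Im ?v\<bar>" using pi_gt3 by (simp add: abs_mult mult_le_cancel_right1)
  have s: "exp \<bar>Im ?v\<bar> / 4 \<le> norm (sin ?v)" using Im assms by (intro norm_sin_ge) linarith
  have "norm (csc2_pi u) = (pi / norm (sin ?v))\<^sup>2"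
    by (simp add: csc2_pi_def norm_power norm_divide)
  also have "\<dots> \<le> (pi / (exp \<bar>Im ?v\<bar> / 4))\<^sup>2"
    using s by (intro power_mono divide_left_mono) (auto intro!: mult_pos_pos less_le_trans[OF _ s])
  also have "\<dots> = 16 * pi\<^sup>2 * exp (- (2 * \<bar>Im ?v\<bar>))"
    by (simp add: power_divide exp_double[symmetric] exp_minus field_simps)
  also have "\<dots> \<le> 16 * pi\<^sup>2 * exp (- \<bar>Im u\<bar>)" using Im by (intro mult_left_mono) auto
  finally show ?thesis .
qed

text \<open>In the upper half plane cot v + i = exp(i v) / sin v, where the numerator decays and the
  denominator grows; the lower half plane follows by oddness. These limits of the cotangent are the
  constants subtracted in \<open>cot_sum\<close>.\<close>

lemma norm_cot_pi_limit_le: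
  assumes "\<bar>Im u\<bar> \<ge> 1"
  shows "norm (cot_pi u + of_real (pi * sgn (Im u)) * \<i>) \<le> 4 * pi * exp (- \<bar>Im u\<bar>)"
proof -
  have *: "norm (cot_pi u + of_real pi * \<i>) \<le> 4 * pi * exp (- Im u)" if "Im u \<ge> 1" for u
  proof -
    let ?v = "of_real pi * u"
    have Im: "Im u \<le> Im ?v" using pi_gt3 that by (simp add: mult_le_cancel_right1)
    then have "\<bar>Im ?v\<bar> = Im ?v" "1 \<le> \<bar>Im ?v\<bar>" using that by linarith+
    then have s: "exp (Im ?v) / 4 \<le> norm (sin ?v)" using norm_sin_ge[of ?v] by simp
    have "0 < norm (sin ?v)" by (rule less_le_trans[OF _ s]) simp
    then have s0: "sin ?v \<noteq> 0" by simp
    have "cot_pi u + of_real pi * \<i> = of_real pi * exp (\<i> * ?v) / sin ?v"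
      using s0 by (simp add: cot_pi_def cot_def exp_Euler field_simps)
    then have "norm (cot_pi u + of_real pi * \<i>) = pi * exp (- Im ?v) / norm (sin ?v)"
      by (simp add: norm_mult norm_divide)
    also have "\<dots> \<le> pi * exp (- Im ?v) / (exp (Im ?v) / 4)"
      using s by (intro divide_left_mono) (auto intro!: mult_pos_pos less_le_trans[OF _ s])
    also have "\<dots> = 4 * pi * exp (- (2 * Im ?v))"
      by (simp add: exp_double[symmetric] exp_minus power2_eq_square field_simps flip: exp_add)
    also have "\<dots> \<le> 4 * pi * exp (- Im u)" using Im that by (intro mult_left_mono) auto
    finally show ?thesis .
  qed
  show ?thesis
  proof (cases "Im u > 0")
    case True
    then show ?thesis using *[of u] assms by simp
  next
    case False
    then have "norm (cot_pi (- u) + of_real pi * \<i>) \<le> 4 * pi * exp (- \<bar>Im u\<bar>)"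
      using *[of "- u"] assms by simp
    moreover have "cot_pi (- u) + of_real pi * \<i> = - (cot_pi u - of_real pi * \<i>)"
      by (simp add: cot_pi_minus)
    ultimately show ?thesis using False assms norm_minus_cancel
      by (simp add: sgn_if split: if_splits) (metis norm_minus_commute)
  qed
qed

section \<open>Partial fractions from the Gamma reflection formula\<close>

lemma has_sum_int_of_sums:
  fixes f :: "int \<Rightarrow> complex"
  assumes "(\<lambda>k. f (- int k)) sums a" "summable (\<lambda>k. norm (f (- int k)))"
    and "(\<lambda>k. f (int k + 1)) sums b" "summable (\<lambda>k. norm (f (int k + 1)))"
  shows "(f has_sum (a + b)) UNIV"
proof -
  have U: "(UNIV :: int set) = range (\<lambda>k. - int k) \<union> range (\<lambda>k. int k + 1)"
  proof -
    have "n \<in> range (\<lambda>k. - int k) \<union> range (\<lambda>k. int k + 1)" for n :: int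
    proof (cases "n \<le> 0")
      case True
      then have "n = - int (nat (- n))" by simp
      then show ?thesis by blast
    next
      case False
      then have "n = int (nat (n - 1)) + 1" by simp
      then show ?thesis by blast
    qed
    then show ?thesis by blast
  qed
  have "(f has_sum a) (range (\<lambda>k. - int k))"
    using assms(1,2) by (subst has_sum_reindex) (auto simp: inj_def o_def intro!: norm_summable_imp_has_sum)
  moreover have "(f has_sum b) (range (\<lambda>k. int k + 1))"
    using assms(3,4) by (subst has_sum_reindex) (auto simp: inj_def o_def intro!: norm_summable_imp_has_sum)
  ultimately show ?thesis unfolding U by (intro has_sum_Un_disjoint) auto
qed

lemma summable_norm_inverse_square_shift:
  "summable (\<lambda>k. norm (1 / (z + of_nat k)\<^sup>2))" for z :: complex
proof (rule summable_comparison_test_ev)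
  show "summable (\<lambda>k. 4 * (1 / real k ^ 2))"
    using inverse_power_summable[of 2, where 'a = real] by (intro summable_mult) (simp add: field_simps)
  show "\<forall>\<^sub>F k in sequentially. norm (norm (1 / (z + of_nat k)\<^sup>2)) \<le> 4 * (1 / real k ^ 2)"
    \<comment> \<open>From this index on, \<open>norm z\<close> is at most half of \<open>k\<close>,
      so \<open>norm (z + of_nat k)\<close> is at least the other half.\<close>
    using eventually_ge_at_top[of "nat \<lceil>2 * norm z\<rceil> + 1"]
  proof eventually_elim
    case (elim k)
    have k: "2 * norm z \<le> real k" "k > 0" using elim by linarith+
    have "real k / 2 \<le> norm (of_nat k :: complex) - norm z" using k by simp
    also have "\<dots> \<le> norm (z + of_nat k)"
      by (metis add.commute norm_diff_ineq)
    finally have "(real k / 2)\<^sup>2 \<le> (norm (z + of_nat k))\<^sup>2" by (intro power_mono) auto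
    then have "1 / (norm (z + of_nat k))\<^sup>2 \<le> 1 / (real k / 2)\<^sup>2"
      using k(2) by (intro frac_le) auto
    then show ?case by (simp add: norm_divide norm_power power_divide)
  qed
qed

lemma not_Int_imp_not_nonpos_Int:
  fixes u :: complex
  assumes "u \<notin> \<int>"
  shows "u \<notin> \<int>\<^sub>\<le>\<^sub>0" "1 - u \<notin> \<int>\<^sub>\<le>\<^sub>0"
  using assms nonpos_Ints_Int Ints_diff[of 1 "1 - u"] by auto

text \<open>Logarithmic derivative of the reflection formula: the Gamma product with arguments u and
  1 - u equals \<pi> / sin \<pi>u, and the derivatives of the two sides are compared.\<close>

lemma cot_pi_eq_Digamma:
  assumes "u \<notin> \<int>"
  shows "cot_pi u = Digamma (1 - u) - Digamma u"
proof -
  note n = not_Int_imp_not_nonpos_Int[OF assms]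
  let ?s = "sin (of_real pi * u)" and ?c = "cos (of_real pi * u)"
  have s: "?s \<noteq> 0" using assms by (simp add: sin_pi_times_eq_0_iff)
  have "((\<lambda>u. Gamma u * Gamma (1 - u)) has_field_derivative
      Gamma u * Gamma (1 - u) * (Digamma u - Digamma (1 - u))) (at u)"
    using n by (auto intro!: derivative_eq_intros simp: algebra_simps)
  moreover have "((\<lambda>u. of_real pi / sin (of_real pi * u)) has_field_derivative
      - (of_real pi * (?c * of_real pi) / ?s\<^sup>2)) (at u)"
    using s by (auto intro!: derivative_eq_intros simp: power2_eq_square)
  ultimately have "of_real pi / ?s * (Digamma u - Digamma (1 - u)) = - (of_real pi * (?c * of_real pi) / ?s\<^sup>2)"
    unfolding Gamma_reflection_complex by (rule DERIV_unique)
  also have "\<dots> = of_real pi / ?s * (- cot_pi u)"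
    by (simp add: cot_pi_def cot_def power2_eq_square)
  finally have "Digamma u - Digamma (1 - u) = - cot_pi u"
    by (subst (asm) mult_cancel_left) (use s in auto)
  then show ?thesis by (simp add: algebra_simps minus_equation_iff)
qed

lemma csc2_pi_eq_Polygamma:
  assumes "u \<notin> \<int>"
  shows "csc2_pi u = Polygamma 1 u + Polygamma 1 (1 - u)"
proof -
  note n = not_Int_imp_not_nonpos_Int[OF assms]
  have op: "open (- \<int> :: complex set)" by (simp add: closed_Ints open_Compl)
  have "((\<lambda>u. Digamma (1 - u) - Digamma u) has_field_derivative
      - Polygamma 1 (1 - u) - Polygamma 1 u) (at u)"
    using n by (auto intro!: derivative_eq_intros)
  then have "(cot_pi has_field_derivative - Polygamma 1 (1 - u) - Polygamma 1 u) (at u)"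
    by (rule has_field_derivative_transform_within_open[OF _ op]) (use assms in \<open>auto simp: cot_pi_eq_Digamma\<close>)
  with has_field_derivative_cot_pi[OF assms] have "- csc2_pi u = - Polygamma 1 (1 - u) - Polygamma 1 u"
    by (rule DERIV_unique)
  then show ?thesis by (simp add: algebra_simps minus_equation_iff)
qed

text \<open>The integers \<open>m = - k\<close> give the series of \<open>Polygamma 1 u\<close>, and
  \<open>m = k + 1\<close> gives that of \<open>Polygamma 1 (1 - u)\<close>, the sign disappearing
  in the square.\<close>

lemma has_sum_csc2_pi:
  assumes "u \<notin> \<int>"
  shows "((\<lambda>m::int. 1 / (u - of_int m)\<^sup>2) has_sum csc2_pi u) UNIV"
proof -
  have nz: "u \<noteq> 0" "1 - u \<noteq> 0" using assms by auto
  have P: "(\<lambda>k. 1 / (z + of_nat k)\<^sup>2) sums Polygamma 1 z" if "z \<noteq> 0" for z :: complex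
    using Polygamma_LIMSEQ[OF that, of 1] by (simp add: field_simps power2_eq_square)
  have eq: "u - of_int (int k + 1) = - (1 - u + of_nat k)" for k by (simp add: algebra_simps)
  show ?thesis
    unfolding csc2_pi_eq_Polygamma[OF assms]
  proof (rule has_sum_int_of_sums)
    show "(\<lambda>k. 1 / (u - of_int (- int k))\<^sup>2) sums Polygamma 1 u"
      using P[OF nz(1)] by simp
    show "summable (\<lambda>k. norm (1 / (u - of_int (- int k))\<^sup>2))"
      using summable_norm_inverse_square_shift[of u] by simp
    show "(\<lambda>k. 1 / (u - of_int (int k + 1))\<^sup>2) sums Polygamma 1 (1 - u)"
      unfolding eq power2_minus by (rule P[OF nz(2)])
    show "summable (\<lambda>k. norm (1 / (u - of_int (int k + 1))\<^sup>2))"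
      unfolding eq power2_minus by (rule summable_norm_inverse_square_shift)
  qed
qed

text \<open>Twice the Basel sum: the term \<open>m = 0\<close> counts as 0 because
  \<open>1 / 0 = 0\<close>.\<close>

lemma inverse_squares_has_sum_int:
  "((\<lambda>m::int. 1 / (of_int m)\<^sup>2) has_sum (of_real (pi\<^sup>2 / 3) :: complex)) UNIV"
proof -
  have "(\<lambda>k. complex_of_real (1 / (real k + 1)\<^sup>2)) sums of_real (pi\<^sup>2 / 6)"
    using inverse_squares_sums by (subst sums_of_real_iff) (simp add: add_ac)
  then have b: "(\<lambda>k. 1 / (1 + of_nat k)\<^sup>2) sums (of_real (pi\<^sup>2 / 6) :: complex)"
    by (simp add: add_ac)
  then have a: "(\<lambda>k. 1 / (0 + of_nat k)\<^sup>2) sums (of_real (pi\<^sup>2 / 6) :: complex)"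
    using sums_Suc_iff[of "\<lambda>k. 1 / (0 + of_nat k :: complex)\<^sup>2"] by simp
  have "((\<lambda>m::int. 1 / (of_int m)\<^sup>2) has_sum (of_real (pi\<^sup>2 / 6) + of_real (pi\<^sup>2 / 6) :: complex)) UNIV"
    by (rule has_sum_int_of_sums)
       (use a b summable_norm_inverse_square_shift[of 0] summable_norm_inverse_square_shift[of 1]
        in \<open>simp_all add: add_ac\<close>)
  then show ?thesis by (simp flip: of_real_add add: field_simps)
qed

section \<open>Trigonometric series over the rows of the lattice\<close>

text \<open>Here \<open>h n w\<close> stands for a lower bound on the distance of the n-th argument
  from the real axis. Exponential decay is asked for only where this bound is at least 1; since it
  grows linearly in \<bar>n\<bar> uniformly on compact sets, finitely many indices escape and the
  M-test applies. The factor \<open>1 + \<bar>n\<bar>\<close> leaves room for weights.\<close>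

lemma has_sum_has_field_derivative_exp_decay:
  fixes f :: "int \<Rightarrow> complex \<Rightarrow> complex"
  assumes "open U" "z \<in> U" "\<And>n. n \<in> A \<Longrightarrow> f n holomorphic_on U"
    and decay: "\<And>n w. n \<in> A \<Longrightarrow> w \<in> U \<Longrightarrow> h n w \<ge> 1 \<Longrightarrow>
      norm (f n w) \<le> c * (1 + \<bar>of_int n\<bar>) * exp (- h n w)"
    and height: "\<And>K. compact K \<Longrightarrow> K \<subseteq> U \<Longrightarrow>
      \<exists>b B. b > 0 \<and> (\<forall>n\<in>A. \<forall>w\<in>K. h n w \<ge> b * \<bar>of_int n\<bar> - B)"
    and c: "c \<ge> 0"
  obtains D where "(\<lambda>n. f n z) summable_on A"
    and "((\<lambda>w. \<Sum>\<^sub>\<infinity>n\<in>A. f n w) has_field_derivative D) (at z)"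
    and "((\<lambda>n. deriv (f n) z) has_sum D) A"
proof (rule has_sum_has_field_derivative_locally_dominated[OF assms(1,2,3)])
  fix K assume K: "compact K" "K \<subseteq> U"
  obtain b B where b: "b > 0" and B: "\<And>n w. n \<in> A \<Longrightarrow> w \<in> K \<Longrightarrow> h n w \<ge> b * \<bar>of_int n\<bar> - B"
    using height[OF K] by auto
  \<comment> \<open>Outside this range \<open>b * \<bar>n\<bar> - B > 1\<close>, so the decay
    hypothesis is available.\<close>
  define N where "N = {- \<lceil>(B + 1) / b\<rceil>..\<lceil>(B + 1) / b\<rceil>}"
  define M where "M n = c * exp B * ((1 + \<bar>real_of_int n\<bar>) * exp (- b * \<bar>real_of_int n\<bar>))" for n
  have "M summable_on A"
    unfolding M_def by (intro summable_on_cmult_right summable_on_int_nat_times_exp b)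
  moreover have "norm (f n w) \<le> M n" if n: "n \<in> A - N" and w: "w \<in> K" for n w
  proof -
    have "\<bar>n\<bar> > \<lceil>(B + 1) / b\<rceil>" using n by (auto simp: N_def)
    then have "\<bar>real_of_int n\<bar> > (B + 1) / b" by linarith
    then have "b * \<bar>real_of_int n\<bar> > B + 1" using b by (simp add: field_simps)
    with B[of n w] n w have h: "h n w \<ge> 1" "- h n w \<le> B - b * \<bar>real_of_int n\<bar>" by auto
    have "norm (f n w) \<le> c * (1 + \<bar>of_int n\<bar>) * exp (- h n w)"
      using decay[OF _ _ h(1)] n w K(2) by auto
    also have "\<dots> \<le> c * (1 + \<bar>of_int n\<bar>) * exp (B - b * \<bar>real_of_int n\<bar>)"
      using h(2) c by (intro mult_left_mono) auto
    also have "\<dots> = M n" by (simp add: M_def exp_diff exp_minus field_simps)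
    finally show ?thesis .
  qed
  ultimately show "\<exists>M N. finite N \<and> M summable_on A \<and> (\<forall>n\<in>A - N. \<forall>w\<in>K. norm (f n w) \<le> M n)"
    by (intro exI[of _ M] exI[of _ N]) (auto simp: N_def)
qed (use that in blast)

lemma compact_imp_abs_Im_le:
  assumes "compact K"
  obtains B where "\<And>w. w \<in> K \<Longrightarrow> \<bar>Im w\<bar> \<le> B"
proof -
  obtain B where "\<And>w. w \<in> K \<Longrightarrow> norm w \<le> B"
    using compact_imp_bounded[OF assms] by (auto simp: bounded_iff)
  then show ?thesis using that abs_Im_le_cmod order_trans by meson
qed

lemma has_field_derivative_csc2_pi:
  assumes "u \<notin> \<int>"
  shows "(csc2_pi has_field_derivative deriv csc2_pi u) (at u)"
proof -
  have "open (- \<int> :: complex set)" by (simp add: closed_Ints open_Compl)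
  moreover have "csc2_pi holomorphic_on - \<int>"
    using holomorphic_on_csc2_pi[of "\<lambda>z. z" "- \<int>"] by auto
  ultimately show ?thesis using assms by (auto intro: holomorphic_derivI)
qed

lemma has_sum_int_even_odd:
  fixes f :: "int \<Rightarrow> complex"
  assumes "((\<lambda>m. f (2 * m)) has_sum a) UNIV" "((\<lambda>m. f (2 * m + 1)) has_sum b) UNIV"
  shows "(f has_sum (a + b)) UNIV"
proof -
  have U: "(UNIV :: int set) = range (\<lambda>m. 2 * m) \<union> range (\<lambda>m. 2 * m + 1)"
  proof -
    have "n \<in> range (\<lambda>m. 2 * m) \<union> range (\<lambda>m. 2 * m + 1)" for n :: int
    proof -
      have "n = 2 * (n div 2) \<or> n = 2 * (n div 2) + 1" by presburger
      then show ?thesis by blast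
    qed
    then show ?thesis by blast
  qed
  have e: "(f has_sum a) (range (\<lambda>m. 2 * m))" and o: "(f has_sum b) (range (\<lambda>m. 2 * m + 1))"
    using assms by (subst has_sum_reindex; simp add: inj_def o_def)+
  have "2 * m \<noteq> 2 * k + 1" for m k :: int by presburger
  then have "range (\<lambda>m::int. 2 * m) \<inter> range (\<lambda>m. 2 * m + 1) = {}" by blast
  from has_sum_Un_disjoint[OF e o this] show ?thesis by (simp only: U[symmetric])
qed

text \<open>This series and the two that follow are P, Q and Z of the opening outline.\<close>

definition csc2_sum :: "complex \<Rightarrow> complex \<Rightarrow> complex" where
  "csc2_sum \<tau> z = (\<Sum>\<^sub>\<infinity>n. csc2_pi (z - of_int n * \<tau>))"

definition csc2_sum_weighted :: "complex \<Rightarrow> complex \<Rightarrow> complex" where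
  "csc2_sum_weighted \<tau> z = (\<Sum>\<^sub>\<infinity>n. of_int n * csc2_pi (z - of_int n * \<tau>))"

text \<open>For large \<bar>n\<bar> the argument lies far from the real axis on the side opposite to
  the sign of \<open>n\<close>, where \<open>cot_pi\<close> tends to \<pi> i sgn n; subtracting this
  limit makes the terms decay exponentially.\<close>

definition cot_sum :: "complex \<Rightarrow> complex \<Rightarrow> complex" where
  "cot_sum \<tau> z = (\<Sum>\<^sub>\<infinity>n. cot_pi (z - of_int n * \<tau>) - of_real pi * \<i> * of_int (sgn n))"

text \<open>
  At an integer \<^const>\<open>csc2_pi\<close> has the value 0 (division by zero), so the term \<open>n = 0\<close> drops out
  of the sum below; its place is taken by \<open>\<pi>\<^sup>2 / 3\<close>, the sum of \<open>1 / m\<^sup>2\<close> over all integers \<open>m \<noteq> 0\<close>.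
\<close>

definition G2 :: "complex \<Rightarrow> complex" where
  "G2 \<tau> = of_real (pi\<^sup>2 / 3) + csc2_sum \<tau> 0"

locale upper_half_plane =
  fixes \<tau> :: complex
  assumes Im_tau: "Im \<tau> > 0"
begin

text \<open>The weight \<open>a\<close> lets one statement serve P (weight 1) and Q (weight n). The
  index set \<open>A\<close> is all integers away from the lattice, and omits 0 near the origin,
  where the row through 0 has its pole.\<close>

lemma csc2_series:
  fixes a :: "int \<Rightarrow> complex"
  assumes "open U" "z \<in> U" and nonint: "\<And>n w. n \<in> A \<Longrightarrow> w \<in> U \<Longrightarrow> w - of_int n * \<tau> \<notin> \<int>"
    and a: "\<And>n. norm (a n) \<le> 1 + \<bar>of_int n\<bar>"
  obtains D where "(\<lambda>n. a n * csc2_pi (z - of_int n * \<tau>)) summable_on A"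
    and "((\<lambda>w. \<Sum>\<^sub>\<infinity>n\<in>A. a n * csc2_pi (w - of_int n * \<tau>)) has_field_derivative D) (at z)"
    and "((\<lambda>n. a n * deriv csc2_pi (z - of_int n * \<tau>)) has_sum D) A"
proof (rule has_sum_has_field_derivative_exp_decay[OF assms(1,2),
      of A "\<lambda>n w. a n * csc2_pi (w - of_int n * \<tau>)" "\<lambda>n w. \<bar>of_int n\<bar> * Im \<tau> - \<bar>Im w\<bar>" "16 * pi\<^sup>2"])
  fix n assume n: "n \<in> A"
  show "(\<lambda>w. a n * csc2_pi (w - of_int n * \<tau>)) holomorphic_on U"
    using nonint[OF n] by (intro holomorphic_intros holomorphic_on_csc2_pi) auto
  fix w assume w: "w \<in> U" "1 \<le> \<bar>of_int n\<bar> * Im \<tau> - \<bar>Im w\<bar>"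
  have Im: "\<bar>of_int n\<bar> * Im \<tau> - \<bar>Im w\<bar> \<le> \<bar>Im (w - of_int n * \<tau>)\<bar>"
    using Im_tau abs_triangle_ineq2_sym[of "of_int n * Im \<tau>" "Im w"] by (simp add: abs_mult)
  have "norm (a n * csc2_pi (w - of_int n * \<tau>)) \<le>
      (1 + \<bar>of_int n\<bar>) * (16 * pi\<^sup>2 * exp (- \<bar>Im (w - of_int n * \<tau>)\<bar>))"
    unfolding norm_mult using Im w by (intro mult_mono a norm_csc2_pi_le) auto
  also have "\<dots> \<le> (1 + \<bar>of_int n\<bar>) * (16 * pi\<^sup>2 * exp (- (\<bar>of_int n\<bar> * Im \<tau> - \<bar>Im w\<bar>)))"
    using Im by (intro mult_left_mono) auto
  finally show "norm (a n * csc2_pi (w - of_int n * \<tau>)) \<le>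
      16 * pi\<^sup>2 * (1 + \<bar>of_int n\<bar>) * exp (- (\<bar>of_int n\<bar> * Im \<tau> - \<bar>Im w\<bar>))"
    by (simp add: mult_ac)
next
  fix K :: "complex set" assume "compact K"
  then obtain B where B: "\<And>w. w \<in> K \<Longrightarrow> \<bar>Im w\<bar> \<le> B" using compact_imp_abs_Im_le by blast
  show "\<exists>b B. b > 0 \<and> (\<forall>n\<in>A. \<forall>w\<in>K. b * \<bar>of_int n\<bar> - B \<le> \<bar>of_int n\<bar> * Im \<tau> - \<bar>Im w\<bar>)"
    using Im_tau B by (intro exI[of _ "Im \<tau>"] exI[of _ B]) (auto simp: mult.commute)
next
  fix D assume D: "(\<lambda>n. a n * csc2_pi (z - of_int n * \<tau>)) summable_on A"
    "((\<lambda>w. \<Sum>\<^sub>\<infinity>n\<in>A. a n * csc2_pi (w - of_int n * \<tau>)) has_field_derivative D) (at z)"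
    "((\<lambda>n. deriv (\<lambda>w. a n * csc2_pi (w - of_int n * \<tau>)) z) has_sum D) A"
  have "deriv (\<lambda>w. a n * csc2_pi (w - of_int n * \<tau>)) z = a n * deriv csc2_pi (z - of_int n * \<tau>)"
    if "n \<in> A" for n
  proof -
    have "((\<lambda>w. csc2_pi (w - of_int n * \<tau>)) has_field_derivative deriv csc2_pi (z - of_int n * \<tau>) * 1) (at z)"
      by (rule DERIV_chain2[where g = "\<lambda>w. w - of_int n * \<tau>", OF has_field_derivative_csc2_pi[OF nonint[OF that assms(2)]]])
         (auto intro!: derivative_eq_intros)
    then show ?thesis by (intro DERIV_imp_deriv DERIV_cmult) simp
  qed
  with D(3) have "((\<lambda>n. a n * deriv csc2_pi (z - of_int n * \<tau>)) has_sum D) A"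
    by (simp cong: has_sum_cong)
  with D show thesis using that by blast
qed auto

lemma cot_series:
  assumes "open U" "z \<in> U" and nonint: "\<And>n w. n \<in> A \<Longrightarrow> w \<in> U \<Longrightarrow> w - of_int n * \<tau> \<notin> \<int>"
  shows "(\<lambda>n. cot_pi (z - of_int n * \<tau>) - of_real pi * \<i> * of_int (sgn n)) summable_on A"
    and "((\<lambda>w. \<Sum>\<^sub>\<infinity>n\<in>A. cot_pi (w - of_int n * \<tau>) - of_real pi * \<i> * of_int (sgn n))
      has_field_derivative - (\<Sum>\<^sub>\<infinity>n\<in>A. csc2_pi (z - of_int n * \<tau>))) (at z)"
proof -
  obtain D where D: "(\<lambda>n. cot_pi (z - of_int n * \<tau>) - of_real pi * \<i> * of_int (sgn n)) summable_on A"
    "((\<lambda>w. \<Sum>\<^sub>\<infinity>n\<in>A. cot_pi (w - of_int n * \<tau>) - of_real pi * \<i> * of_int (sgn n)) has_field_derivative D) (at z)"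
    "((\<lambda>n. deriv (\<lambda>w. cot_pi (w - of_int n * \<tau>) - of_real pi * \<i> * of_int (sgn n)) z) has_sum D) A"
  proof (rule has_sum_has_field_derivative_exp_decay[OF assms(1,2),
        of A "\<lambda>n w. cot_pi (w - of_int n * \<tau>) - of_real pi * \<i> * of_int (sgn n)"
           "\<lambda>n w. \<bar>of_int n\<bar> * Im \<tau> - \<bar>Im w\<bar>" "4 * pi"])
    fix n assume n: "n \<in> A"
    show "(\<lambda>w. cot_pi (w - of_int n * \<tau>) - of_real pi * \<i> * of_int (sgn n)) holomorphic_on U"
      using nonint[OF n] by (intro holomorphic_intros holomorphic_on_cot_pi) auto
    fix w assume w: "w \<in> U" "1 \<le> \<bar>of_int n\<bar> * Im \<tau> - \<bar>Im w\<bar>"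
    let ?u = "w - of_int n * \<tau>"
    have Im: "\<bar>of_int n\<bar> * Im \<tau> - \<bar>Im w\<bar> \<le> \<bar>Im ?u\<bar>"
      using Im_tau abs_triangle_ineq2_sym[of "of_int n * Im \<tau>" "Im w"] by (simp add: abs_mult)
    \<comment> \<open>The height condition forces \<open>n\<close> to be nonzero and \<bar>n\<bar>
      Im \<tau> to exceed \<bar>Im w\<bar>, so the sign of \<open>n\<close> decides on which side of
      the real axis the argument lies.\<close>
    have "sgn (Im ?u) = - sgn (of_int n)"
    proof (cases "n > 0")
      case True
      then have "Im ?u < 0" using w(2) abs_ge_self[of "Im w"] by simp
      with True show ?thesis by simp
    next
      case False
      then have "n < 0" using w(2) Im_tau by (cases "n = 0") auto
      then have "Im ?u > 0" using w(2) abs_ge_minus_self[of "Im w"] by simp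
      with \<open>n < 0\<close> show ?thesis by simp
    qed
    then have "of_real pi * \<i> * of_int (sgn n) = - (of_real (pi * sgn (Im ?u)) * \<i> :: complex)"
      by (cases n "0::int" rule: linorder_cases) simp_all
    then have "norm (cot_pi ?u - of_real pi * \<i> * of_int (sgn n)) \<le> 4 * pi * exp (- \<bar>Im ?u\<bar>)"
      using norm_cot_pi_limit_le[of ?u] Im w by simp
    moreover have c1: "4 * pi \<le> 4 * pi * (1 + \<bar>real_of_int n\<bar>)"
      using mult_left_mono[of 1 "1 + \<bar>real_of_int n\<bar>" "4 * pi"] by simp
    have "4 * pi * exp (- \<bar>Im ?u\<bar>) \<le> (4 * pi * (1 + \<bar>of_int n\<bar>)) * exp (- (\<bar>of_int n\<bar> * Im \<tau> - \<bar>Im w\<bar>))"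
      using Im by (intro mult_mono c1) auto
    ultimately show "norm (cot_pi ?u - of_real pi * \<i> * of_int (sgn n)) \<le>
        4 * pi * (1 + \<bar>of_int n\<bar>) * exp (- (\<bar>of_int n\<bar> * Im \<tau> - \<bar>Im w\<bar>))" by linarith
  next
    fix K :: "complex set" assume "compact K"
    then obtain B where B: "\<And>w. w \<in> K \<Longrightarrow> \<bar>Im w\<bar> \<le> B" using compact_imp_abs_Im_le by blast
    show "\<exists>b B. b > 0 \<and> (\<forall>n\<in>A. \<forall>w\<in>K. b * \<bar>of_int n\<bar> - B \<le> \<bar>of_int n\<bar> * Im \<tau> - \<bar>Im w\<bar>)"
      using Im_tau B by (intro exI[of _ "Im \<tau>"] exI[of _ B]) (auto simp: mult.commute)
  qed (auto intro: that)
  have "deriv (\<lambda>w. cot_pi (w - of_int n * \<tau>) - of_real pi * \<i> * of_int (sgn n)) z = - csc2_pi (z - of_int n * \<tau>)"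
    if "n \<in> A" for n
  proof -
    have "((\<lambda>w. cot_pi (w - of_int n * \<tau>)) has_field_derivative - csc2_pi (z - of_int n * \<tau>) * 1) (at z)"
      by (rule DERIV_chain2[where g = "\<lambda>w. w - of_int n * \<tau>", OF has_field_derivative_cot_pi[OF nonint[OF that assms(2)]]])
         (auto intro!: derivative_eq_intros)
    then show ?thesis by (intro DERIV_imp_deriv) (auto intro!: derivative_eq_intros)
  qed
  with D(3) have "((\<lambda>n. - csc2_pi (z - of_int n * \<tau>)) has_sum D) A"
    by (simp cong: has_sum_cong)
  then have "D = - (\<Sum>\<^sub>\<infinity>n\<in>A. csc2_pi (z - of_int n * \<tau>))"
    by (metis infsumI infsum_uminus)
  with D(1,2) show "(\<lambda>n. cot_pi (z - of_int n * \<tau>) - of_real pi * \<i> * of_int (sgn n)) summable_on A"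
    "((\<lambda>w. \<Sum>\<^sub>\<infinity>n\<in>A. cot_pi (w - of_int n * \<tau>) - of_real pi * \<i> * of_int (sgn n))
      has_field_derivative - (\<Sum>\<^sub>\<infinity>n\<in>A. csc2_pi (z - of_int n * \<tau>))) (at z)" by auto
qed

end

text \<open>The point moves with \<tau> while its real coordinates stay fixed, so the n-th argument
  is \<alpha> + (\<beta> - n) t and the chain rule contributes the factor \<beta> - n. From
  \<bar>\<beta>\<bar> at most 1/2 its height is at least (\<bar>n\<bar> - 1/2) Im t, and the
  condition on \<alpha>, \<beta> keeps it off the integers for every t in the upper half
  plane.\<close>

lemma has_field_derivative_csc2_sum_half_period:
  fixes \<alpha> \<beta> :: real
  assumes \<tau>: "Im \<tau> > 0" and \<beta>: "\<bar>\<beta>\<bar> \<le> 1 / 2" and \<alpha>: "\<beta> \<noteq> 0 \<or> \<alpha> \<notin> \<int>"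
  obtains D where "((\<lambda>t. csc2_sum t (of_real \<alpha> + of_real \<beta> * t)) has_field_derivative D) (at \<tau>)"
    and "((\<lambda>n. (of_real \<beta> - of_int n) * deriv csc2_pi (of_real \<alpha> + of_real \<beta> * \<tau> - of_int n * \<tau>)) has_sum D) UNIV"
proof -
  define g where "g n t = of_real \<alpha> + of_real \<beta> * t - of_int n * t" for n :: int and t :: complex
  have nonint: "g n t \<notin> \<int>" if "Im t > 0" for n t
  proof
    assume "g n t \<in> \<int>"
    then obtain m where m: "g n t = of_int m" by (auto elim: Ints_cases)
    have "Im (g n t) = (\<beta> - of_int n) * Im t" by (simp add: g_def algebra_simps)
    with m that have \<beta>n: "\<beta> = of_int n" by simp
    then have "n = 0" using \<beta> by linarith
    with \<beta>n have "\<beta> = 0" by simp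
    moreover have "\<alpha> = of_int m"
      using m \<beta>n by (simp add: g_def complex_eq_iff)
    ultimately show False using \<alpha> by simp
  qed
  define U where "U = {t. Im t > 0}"
  have U: "open U" "\<tau> \<in> U" unfolding U_def using \<tau> by (auto simp: open_halfspace_Im_gt)
  obtain D where D:
    "((\<lambda>t. \<Sum>\<^sub>\<infinity>n. csc2_pi (g n t)) has_field_derivative D) (at \<tau>)"
    "((\<lambda>n. deriv (\<lambda>t. csc2_pi (g n t)) \<tau>) has_sum D) UNIV"
  proof (rule has_sum_has_field_derivative_exp_decay[OF U,
        of UNIV "\<lambda>n t. csc2_pi (g n t)" "\<lambda>n t. (\<bar>of_int n\<bar> - 1 / 2) * Im t" "16 * pi\<^sup>2"])
    fix n
    show "(\<lambda>t. csc2_pi (g n t)) holomorphic_on U"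
      using nonint[of _ n] unfolding U_def
      by (intro holomorphic_on_csc2_pi) (auto simp: g_def intro!: holomorphic_intros)
    fix t assume t: "t \<in> U" "1 \<le> (\<bar>of_int n\<bar> - 1 / 2) * Im t"
    have Im: "(\<bar>of_int n\<bar> - 1 / 2) * Im t \<le> \<bar>Im (g n t)\<bar>"
    proof -
      have "\<bar>Im (g n t)\<bar> = \<bar>\<beta> - of_int n\<bar> * Im t"
        using t(1) by (simp add: U_def g_def abs_mult flip: left_diff_distrib)
      moreover have "\<bar>of_int n\<bar> - 1 / 2 \<le> \<bar>\<beta> - of_int n\<bar>" using \<beta> by linarith
      ultimately show ?thesis using t(1) by (auto simp: U_def intro!: mult_right_mono)
    qed
    have "norm (csc2_pi (g n t)) \<le> 16 * pi\<^sup>2 * exp (- \<bar>Im (g n t)\<bar>)"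
      using Im t by (intro norm_csc2_pi_le) auto
    moreover have c1: "16 * pi\<^sup>2 \<le> 16 * pi\<^sup>2 * (1 + \<bar>real_of_int n\<bar>)"
      using mult_left_mono[of 1 "1 + \<bar>real_of_int n\<bar>" "16 * pi\<^sup>2"] by simp
    have "16 * pi\<^sup>2 * exp (- \<bar>Im (g n t)\<bar>) \<le> (16 * pi\<^sup>2 * (1 + \<bar>of_int n\<bar>)) * exp (- ((\<bar>of_int n\<bar> - 1 / 2) * Im t))"
      using Im by (intro mult_mono c1) auto
    ultimately show "norm (csc2_pi (g n t)) \<le> 16 * pi\<^sup>2 * (1 + \<bar>of_int n\<bar>) * exp (- ((\<bar>of_int n\<bar> - 1 / 2) * Im t))" by linarith
  next
    fix K assume K: "compact K" "K \<subseteq> U"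
    obtain B where B: "\<And>w. w \<in> K \<Longrightarrow> \<bar>Im w\<bar> \<le> B" using compact_imp_abs_Im_le[OF K(1)] by blast
    \<comment> \<open>A compact subset of the upper half plane stays at a positive height, which
      supplies the linear growth rate in \<bar>n\<bar>.\<close>
    obtain b where b: "b > 0" "\<And>w. w \<in> K \<Longrightarrow> Im w \<ge> b"
    proof (cases "K = {}")
      case False
      have "continuous_on K Im" by (intro continuous_intros)
      then obtain w where "w \<in> K" "\<And>v. v \<in> K \<Longrightarrow> Im w \<le> Im v"
        using continuous_attains_inf[OF K(1) False] by blast
      then show ?thesis using K(2) by (intro that[of "Im w"]) (auto simp: U_def)
    qed (auto intro: that[of 1])
    have "b * \<bar>of_int n\<bar> - B \<le> (\<bar>of_int n\<bar> - 1 / 2) * Im t" if "t \<in> K" for n :: int and t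
    proof -
      have "b * \<bar>of_int n\<bar> \<le> Im t * \<bar>of_int n\<bar>" using b that by (intro mult_right_mono) auto
      then show ?thesis using B[OF that] b(1) b(2)[OF that] by (simp add: algebra_simps)
    qed
    then show "\<exists>b B. b > 0 \<and> (\<forall>n\<in>UNIV. \<forall>t\<in>K. b * \<bar>of_int n\<bar> - B \<le> (\<bar>of_int n\<bar> - 1 / 2) * Im t)"
      using b(1) by blast
  qed (auto intro: that)
  have "deriv (\<lambda>t. csc2_pi (g n t)) \<tau> = (of_real \<beta> - of_int n) * deriv csc2_pi (g n \<tau>)" for n
  proof -
    have "((\<lambda>t. csc2_pi (g n t)) has_field_derivative deriv csc2_pi (g n \<tau>) * (of_real \<beta> - of_int n)) (at \<tau>)"
      by (rule DERIV_chain2[where g = "g n", OF has_field_derivative_csc2_pi[OF nonint[OF \<tau>]]])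
         (unfold g_def[abs_def], auto intro!: derivative_eq_intros)
    then show ?thesis by (intro DERIV_imp_deriv) (simp add: mult.commute)
  qed
  with D show ?thesis by (intro that[of D]) (auto simp: csc2_sum_def g_def)
qed

section \<open>Quasi-periodicity\<close>

lemma deriv_shift:
  assumes "f holomorphic_on S" "g holomorphic_on S" "open S" "z \<in> S" "z + c \<in> S"
    and eq: "\<And>w. w \<in> S \<Longrightarrow> f (w + c) = f w + g w"
  shows "deriv f (z + c) = deriv f z + deriv g z"
proof -
  have "(f has_field_derivative deriv f (z + c)) (at (z + c))"
    using assms by (intro holomorphic_derivI)
  then have "((\<lambda>w. f (w + c)) has_field_derivative deriv f (z + c)) (at z)"
    by (simp add: DERIV_shift)
  moreover have "((\<lambda>w. f w + g w) has_field_derivative deriv f z + deriv g z) (at z)"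
    using assms by (intro DERIV_add holomorphic_derivI)
  then have "((\<lambda>w. f (w + c)) has_field_derivative deriv f z + deriv g z) (at z)"
    by (rule has_field_derivative_transform_within_open[OF _ assms(3,4)]) (simp add: eq)
  ultimately show ?thesis by (rule DERIV_unique)
qed

text \<open>\<open>f\<close> vanishes at 0 and \<open>f1 = f / z\<close> is even, so
  \<open>f1\<close> has derivative 0 there. Thus the coefficients of degree 0 and 2 vanish, and
  three divisions by z leave a holomorphic factor.\<close>

lemma odd_holomorphic_factor:
  assumes f: "f holomorphic_on ball 0 r" and r: "r > 0"
    and odd: "\<And>z. z \<in> ball 0 r \<Longrightarrow> f (- z) = - f z"
  obtains k where "k holomorphic_on ball 0 r"
    "\<And>z. z \<in> ball 0 r \<Longrightarrow> f z = deriv f 0 * z + z ^ 3 * k z"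
proof -
  \<comment> \<open>Difference quotient at 0 with its removable singularity filled in.\<close>
  define q where "q h z = (if z = 0 then deriv h 0 else (h z - h 0) / (z - 0))" for h and z :: complex
  have q: "q h holomorphic_on ball 0 r" if "h holomorphic_on ball 0 r" for h
    unfolding q_def by (rule pole_lemma_open[OF that open_ball])
  have hq: "h z = h 0 + z * q h z" for h z by (simp add: q_def)
  have f0: "f 0 = 0" using odd[of 0] r by simp
  define f1 where "f1 = q f"
  define f2 where "f2 = q f1"
  have holo: "f1 holomorphic_on ball 0 r" "f2 holomorphic_on ball 0 r" "q f2 holomorphic_on ball 0 r"
    unfolding f1_def f2_def by (intro q f)+
  have even: "f1 (- z) = f1 z" if "z \<in> ball 0 r" for z :: complex
    using odd[OF that] by (simp add: f1_def q_def f0)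
  have "(f1 has_field_derivative deriv f1 0) (at (- 0))"
    using holomorphic_derivI[OF holo(1) open_ball, of 0] r by simp
  then have "((\<lambda>z. f1 (- z)) has_field_derivative deriv f1 0 * (- 1)) (at 0)"
    by (rule DERIV_chain2) (auto intro!: derivative_eq_intros)
  then have "(f1 has_field_derivative deriv f1 0 * (- 1)) (at 0)"
    by (rule has_field_derivative_transform_within_open[where S = "ball 0 r"]) (use even r in auto)
  then have "deriv f1 0 = deriv f1 0 * (- 1)" by (rule DERIV_imp_deriv)
  then have f20: "f2 0 = 0" by (simp add: f2_def q_def)
  show ?thesis
  proof (rule that[OF holo(3)])
    fix z :: complex assume "z \<in> ball 0 r"
    have "f z = z * (f1 0 + z * (z * q f2 z))"
      using hq[of f z] hq[of f1 z] hq[of f2 z] by (simp add: f0 f20 flip: f1_def f2_def)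
    then show "f z = deriv f 0 * z + z ^ 3 * q f2 z"
      by (simp add: f1_def q_def[of f 0] algebra_simps power3_eq_cube)
  qed
qed

lemma Polygamma_1_1: "Polygamma 1 1 = (of_real (pi\<^sup>2 / 6) :: complex)"
proof -
  have "(\<lambda>k. complex_of_real (1 / (real k + 1)\<^sup>2)) sums of_real (pi\<^sup>2 / 6)"
    using inverse_squares_sums by (subst sums_of_real_iff) (simp add: add_ac)
  moreover have "complex_of_real (1 / (real k + 1)\<^sup>2) = inverse ((1 + of_nat k) ^ Suc 1)" for k
    by (simp add: power2_eq_square inverse_eq_divide add.commute)
  ultimately have "(\<lambda>k. inverse ((1 + of_nat k) ^ Suc 1)) sums (of_real (pi\<^sup>2 / 6) :: complex)"
    by (simp only:)
  moreover have "(\<lambda>k. inverse ((1 + of_nat k) ^ Suc 1)) sums (Polygamma 1 1 :: complex)"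
    using Polygamma_LIMSEQ[of "1 :: complex" 1] by simp
  ultimately show ?thesis using sums_unique2 by blast
qed

lemma csc2_sum_plus_1: "csc2_sum \<tau> (z + 1) = csc2_sum \<tau> z"
  and csc2_sum_weighted_plus_1: "csc2_sum_weighted \<tau> (z + 1) = csc2_sum_weighted \<tau> z"
  and cot_sum_plus_1: "cot_sum \<tau> (z + 1) = cot_sum \<tau> z"
proof -
  have "z + 1 - of_int n * \<tau> = z - of_int n * \<tau> + 1" for n by simp
  then show "csc2_sum \<tau> (z + 1) = csc2_sum \<tau> z"
    "csc2_sum_weighted \<tau> (z + 1) = csc2_sum_weighted \<tau> z" "cot_sum \<tau> (z + 1) = cot_sum \<tau> z"
    unfolding csc2_sum_def csc2_sum_weighted_def cot_sum_def
    by (simp_all only: csc2_pi_plus_1 cot_pi_plus_1)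
qed

lemma csc2_sum_plus_tau: "csc2_sum \<tau> (z + \<tau>) = csc2_sum \<tau> z"
  using infsum_int_shift[of "\<lambda>n. csc2_pi (z + \<tau> - of_int n * \<tau>)" 1]
  by (simp add: csc2_sum_def algebra_simps)

lemma csc2_sum_minus: "csc2_sum \<tau> (- z) = csc2_sum \<tau> z"
  using infsum_int_minus[of "\<lambda>n. csc2_pi (- z - of_int n * \<tau>)"]
    csc2_pi_minus[of "z - of_int n * \<tau>" for n]
  by (simp add: csc2_sum_def)

context upper_half_plane
begin

lemma not_in_period_latticeD: "z \<notin> period_lattice \<tau> \<Longrightarrow> z - of_int n * \<tau> \<notin> \<int>"
proof
  assume z: "z \<notin> period_lattice \<tau>" and "z - of_int n * \<tau> \<in> \<int>"
  then obtain m where "z - of_int n * \<tau> = of_int m" by (auto elim: Ints_cases)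
  then have "z = of_int m + of_int n * \<tau>" by (simp add: algebra_simps)
  with z show False unfolding period_lattice_def by blast
qed

lemma open_Compl_period_lattice: "open (- period_lattice \<tau>)"
  using closed_period_lattice[OF Im_tau] by (simp add: open_Compl)

lemma
  assumes z: "z \<notin> period_lattice \<tau>"
  shows has_sum_csc2_sum: "((\<lambda>n. csc2_pi (z - of_int n * \<tau>)) has_sum csc2_sum \<tau> z) UNIV"
    and has_field_derivative_csc2_sum:
      "(csc2_sum \<tau> has_field_derivative deriv (csc2_sum \<tau>) z) (at z)"
    and has_sum_deriv_csc2_sum:
      "((\<lambda>n. deriv csc2_pi (z - of_int n * \<tau>)) has_sum deriv (csc2_sum \<tau>) z) UNIV"
proof -
  obtain D where D: "(\<lambda>n. 1 * csc2_pi (z - of_int n * \<tau>)) summable_on UNIV"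
    "((\<lambda>w. \<Sum>\<^sub>\<infinity>n. 1 * csc2_pi (w - of_int n * \<tau>)) has_field_derivative D) (at z)"
    "((\<lambda>n. 1 * deriv csc2_pi (z - of_int n * \<tau>)) has_sum D) UNIV"
    by (rule csc2_series[OF open_Compl_period_lattice, where A = UNIV and a = "\<lambda>_. 1" and z = z])
       (use z not_in_period_latticeD in auto)
  then have "(csc2_sum \<tau> has_field_derivative D) (at z)"
    by (simp add: csc2_sum_def[abs_def])
  then have "deriv (csc2_sum \<tau>) z = D" by (rule DERIV_imp_deriv)
  with D \<open>(csc2_sum \<tau> has_field_derivative D) (at z)\<close>
  show "((\<lambda>n. csc2_pi (z - of_int n * \<tau>)) has_sum csc2_sum \<tau> z) UNIV"
    "(csc2_sum \<tau> has_field_derivative deriv (csc2_sum \<tau>) z) (at z)"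
    "((\<lambda>n. deriv csc2_pi (z - of_int n * \<tau>)) has_sum deriv (csc2_sum \<tau>) z) UNIV"
    by (simp_all add: csc2_sum_def)
qed

lemma
  assumes z: "z \<notin> period_lattice \<tau>"
  shows has_sum_csc2_sum_weighted:
      "((\<lambda>n. of_int n * csc2_pi (z - of_int n * \<tau>)) has_sum csc2_sum_weighted \<tau> z) UNIV"
    and has_field_derivative_csc2_sum_weighted:
      "(csc2_sum_weighted \<tau> has_field_derivative deriv (csc2_sum_weighted \<tau>) z) (at z)"
    and has_sum_deriv_csc2_sum_weighted:
      "((\<lambda>n. of_int n * deriv csc2_pi (z - of_int n * \<tau>)) has_sum deriv (csc2_sum_weighted \<tau>) z) UNIV"
proof -
  obtain D where D: "(\<lambda>n. of_int n * csc2_pi (z - of_int n * \<tau>)) summable_on UNIV"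
    "((\<lambda>w. \<Sum>\<^sub>\<infinity>n. of_int n * csc2_pi (w - of_int n * \<tau>)) has_field_derivative D) (at z)"
    "((\<lambda>n. of_int n * deriv csc2_pi (z - of_int n * \<tau>)) has_sum D) UNIV"
    by (rule csc2_series[OF open_Compl_period_lattice, where A = UNIV and a = of_int and z = z])
       (use z not_in_period_latticeD in auto)
  then have "(csc2_sum_weighted \<tau> has_field_derivative D) (at z)"
    by (simp add: csc2_sum_weighted_def[abs_def])
  then have "deriv (csc2_sum_weighted \<tau>) z = D" by (rule DERIV_imp_deriv)
  with D \<open>(csc2_sum_weighted \<tau> has_field_derivative D) (at z)\<close>
  show "((\<lambda>n. of_int n * csc2_pi (z - of_int n * \<tau>)) has_sum csc2_sum_weighted \<tau> z) UNIV"
    "(csc2_sum_weighted \<tau> has_field_derivative deriv (csc2_sum_weighted \<tau>) z) (at z)"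
    "((\<lambda>n. of_int n * deriv csc2_pi (z - of_int n * \<tau>)) has_sum deriv (csc2_sum_weighted \<tau>) z) UNIV"
    by (simp_all add: csc2_sum_weighted_def)
qed

lemma
  assumes z: "z \<notin> period_lattice \<tau>"
  shows has_sum_cot_sum:
      "((\<lambda>n. cot_pi (z - of_int n * \<tau>) - of_real pi * \<i> * of_int (sgn n)) has_sum cot_sum \<tau> z) UNIV"
    and has_field_derivative_cot_sum: "(cot_sum \<tau> has_field_derivative - csc2_sum \<tau> z) (at z)"
  using cot_series[OF open_Compl_period_lattice, of z UNIV] z not_in_period_latticeD
  unfolding csc2_sum_def cot_sum_def[abs_def] by auto

lemma holomorphic_on_csc2_sum: "csc2_sum \<tau> holomorphic_on - period_lattice \<tau>"
  and holomorphic_on_csc2_sum_weighted: "csc2_sum_weighted \<tau> holomorphic_on - period_lattice \<tau>"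
  and holomorphic_on_cot_sum: "cot_sum \<tau> holomorphic_on - period_lattice \<tau>"
  using has_field_derivative_csc2_sum has_field_derivative_csc2_sum_weighted has_field_derivative_cot_sum
  by (auto simp: holomorphic_on_open open_Compl_period_lattice)

text \<open>Shifting the index by one turns the weight n into n + 1, and the surplus is the
  unweighted series.\<close>

lemma csc2_sum_weighted_plus_tau:
  assumes "z \<notin> period_lattice \<tau>"
  shows "csc2_sum_weighted \<tau> (z + \<tau>) = csc2_sum_weighted \<tau> z + csc2_sum \<tau> z"
proof -
  have "((\<lambda>n. of_int n * csc2_pi (z - of_int n * \<tau>) + csc2_pi (z - of_int n * \<tau>)) has_sum
      (csc2_sum_weighted \<tau> z + csc2_sum \<tau> z)) UNIV"
    by (intro has_sum_add has_sum_csc2_sum has_sum_csc2_sum_weighted assms)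
  then have "csc2_sum_weighted \<tau> z + csc2_sum \<tau> z =
      (\<Sum>\<^sub>\<infinity>n. of_int n * csc2_pi (z - of_int n * \<tau>) + csc2_pi (z - of_int n * \<tau>))"
    by (rule infsumI[symmetric])
  also have "\<dots> = (\<Sum>\<^sub>\<infinity>n. of_int (n + 1) * csc2_pi (z + \<tau> - of_int (n + 1) * \<tau>))"
    by (intro infsum_cong) (simp add: algebra_simps)
  also have "\<dots> = csc2_sum_weighted \<tau> (z + \<tau>)"
    unfolding csc2_sum_weighted_def by (rule infsum_int_shift)
  finally show ?thesis by simp
qed

text \<open>After the index shift only the subtracted constants differ:
  \<open>sgn n - sgn (n + 1)\<close> is -1 at n = -1 and at n = 0, and 0 elsewhere.\<close>

lemma cot_sum_plus_tau:
  assumes "z \<notin> period_lattice \<tau>"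
  shows "cot_sum \<tau> (z + \<tau>) = cot_sum \<tau> z - 2 * of_real pi * \<i>"
proof -
  have "((\<lambda>n::int. of_real pi * \<i> * of_int (sgn n - sgn (n + 1))) has_sum - 2 * of_real pi * \<i>) UNIV"
    by (rule has_sum_finite_neutralI[of "{-1, 0}"]) (auto simp: sgn_if)
  then have "((\<lambda>n. (cot_pi (z - of_int n * \<tau>) - of_real pi * \<i> * of_int (sgn n)) +
      of_real pi * \<i> * of_int (sgn n - sgn (n + 1))) has_sum
      (cot_sum \<tau> z + - 2 * of_real pi * \<i>)) UNIV"
    by (intro has_sum_add has_sum_cot_sum assms)
  then have "cot_sum \<tau> z + - 2 * of_real pi * \<i> =
      (\<Sum>\<^sub>\<infinity>n. (cot_pi (z - of_int n * \<tau>) - of_real pi * \<i> * of_int (sgn n)) +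
        of_real pi * \<i> * of_int (sgn n - sgn (n + 1)))"
    by (rule infsumI[symmetric])
  also have "\<dots> = (\<Sum>\<^sub>\<infinity>n. cot_pi (z + \<tau> - of_int (n + 1) * \<tau>) - of_real pi * \<i> * of_int (sgn (n + 1)))"
    by (intro infsum_cong) (simp add: algebra_simps)
  also have "\<dots> = cot_sum \<tau> (z + \<tau>)"
    unfolding cot_sum_def by (rule infsum_int_shift)
  finally show ?thesis by simp
qed

section \<open>Behaviour near the origin and the elliptic identity\<close>

definition lattice_radius :: real where "lattice_radius = min 1 (Im \<tau>)"

lemma lattice_radius_pos: "lattice_radius > 0"
  using Im_tau by (simp add: lattice_radius_def)

lemma ball_lattice_radius_nonint:
  assumes "z \<in> ball 0 lattice_radius" "n \<noteq> 0"
  shows "z - of_int n * \<tau> \<notin> \<int>"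
proof
  assume "z - of_int n * \<tau> \<in> \<int>"
  then obtain m where m: "z - of_int n * \<tau> = of_int m" by (auto elim: Ints_cases)
  have "Im z - of_int n * Im \<tau> = 0" using arg_cong[OF m, of Im] by simp
  then have "\<bar>of_int n\<bar> * Im \<tau> = \<bar>Im z\<bar>" using Im_tau by (simp add: abs_mult)
  \<comment> \<open>The bound Im \<tau> in the radius keeps the ball strictly between the rows n =
    -1 and n = 1; the bound 1 excludes the nonzero integers.\<close>
  moreover have "\<bar>Im z\<bar> < Im \<tau>"
    using assms(1) abs_Im_le_cmod[of z] by (simp add: lattice_radius_def)
  moreover have "1 * Im \<tau> \<le> \<bar>of_int n\<bar> * Im \<tau>"
    using assms(2) Im_tau by (intro mult_right_mono) auto
  ultimately show False by simp
qed

lemma ball_lattice_radius_not_Int: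
  fixes z :: complex
  assumes "z \<in> ball 0 lattice_radius" "z \<noteq> 0"
  shows "z \<notin> \<int>"
proof
  assume "z \<in> \<int>"
  then obtain m where m: "z = of_int m" by (auto elim: Ints_cases)
  then have "real_of_int \<bar>m\<bar> < 1" using assms(1) by (simp add: lattice_radius_def)
  then have "m = 0" by linarith
  with m assms(2) show False by simp
qed

lemma ball_lattice_radius_Int: "ball 0 lattice_radius \<inter> period_lattice \<tau> \<subseteq> {0}"
proof clarify
  fix z assume z: "z \<in> ball 0 lattice_radius" "z \<in> period_lattice \<tau>"
  then obtain m n where mn: "z = of_int m + of_int n * \<tau>" by (auto simp: period_lattice_def)
  then have "n = 0" using ball_lattice_radius_nonint[OF z(1), of n] by auto
  with mn have "z \<in> \<int>" by simp
  then show "z = 0" using ball_lattice_radius_not_Int[OF z(1)] by blast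
qed

lemma summable_csc2_sum_0: "(\<lambda>n. csc2_pi (of_int n * \<tau>)) summable_on UNIV"
proof -
  have "(\<lambda>n. 1 * csc2_pi (0 - of_int n * \<tau>)) summable_on - {0}"
    by (rule csc2_series[OF open_ball[of 0 lattice_radius], where A = "- {0}" and a = "\<lambda>_. 1" and z = 0])
       (use lattice_radius_pos ball_lattice_radius_nonint in auto)
  then have "(\<lambda>n. csc2_pi (of_int n * \<tau>)) summable_on - {0}" by (simp add: csc2_pi_minus)
  then have "(\<lambda>n. csc2_pi (of_int n * \<tau>)) summable_on insert 0 (- {0})"
    by (simp only: summable_on_insert_iff)
  then show ?thesis by (simp add: insert_UNIV Compl_eq_Diff_UNIV)
qed

text \<open>The weight is 0 on the row through the origin, the only one with a pole in this
  ball.\<close>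

lemma holomorphic_on_csc2_sum_weighted_ball:
  "csc2_sum_weighted \<tau> holomorphic_on ball 0 lattice_radius"
proof -
  have eq: "csc2_sum_weighted \<tau> = (\<lambda>z. \<Sum>\<^sub>\<infinity>n\<in>- {0}. of_int n * csc2_pi (z - of_int n * \<tau>))"
    unfolding csc2_sum_weighted_def by (intro ext infsum_cong_neutral) auto
  have "\<exists>D. (csc2_sum_weighted \<tau> has_field_derivative D) (at z)" if "z \<in> ball 0 lattice_radius" for z
    unfolding eq
    by (rule csc2_series[OF open_ball that, where A = "- {0}" and a = of_int])
       (use ball_lattice_radius_nonint in auto)
  then show ?thesis by (simp add: holomorphic_on_open)
qed

text \<open>The row through 0 carries the pole 1/z; the remainder of that row and all other rows
  form an odd holomorphic function \<open>A\<close>. Oddness removes its constant and quadratic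
  terms, and its derivative at 0 is the linear coefficient.\<close>

lemma cot_sum_Laurent_expansion:
  obtains k where "k holomorphic_on ball 0 lattice_radius"
    "\<And>z. z \<in> ball 0 lattice_radius \<Longrightarrow> z \<noteq> 0 \<Longrightarrow> cot_sum \<tau> z = 1 / z - G2 \<tau> * z + z ^ 3 * k z"
proof -
  define c where "c n z = cot_pi (z - of_int n * \<tau>) - of_real pi * \<i> * of_int (sgn n)" for n z
  define s where "s z = (\<Sum>\<^sub>\<infinity>n\<in>- {0}. c n z)" for z
  \<comment> \<open>\<open>Digamma (1 - z) - Digamma (1 + z)\<close> is \<open>\<pi> cot \<pi>z - 1 / z\<close> with the singularity at 0 removed.\<close>
  define A where "A z = Digamma (1 - z) - Digamma (1 + z) + s z" for z
  have s': "(s has_field_derivative - (\<Sum>\<^sub>\<infinity>n\<in>- {0}. csc2_pi (z - of_int n * \<tau>))) (at z)"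
    and summ: "(\<lambda>n. c n z) summable_on - {0}" if "z \<in> ball 0 lattice_radius" for z
    using cot_series[OF open_ball that, of "- {0}"] ball_lattice_radius_nonint
    unfolding s_def c_def by auto
  have np: "1 - z \<notin> \<int>\<^sub>\<le>\<^sub>0" "1 + z \<notin> \<int>\<^sub>\<le>\<^sub>0" if "z \<in> ball 0 lattice_radius" for z :: complex
  proof -
    have "\<bar>Re z\<bar> < 1" using that abs_Re_le_cmod[of z] by (simp add: lattice_radius_def)
    then show "1 - z \<notin> \<int>\<^sub>\<le>\<^sub>0" "1 + z \<notin> \<int>\<^sub>\<le>\<^sub>0" by (auto elim!: nonpos_Ints_cases simp: complex_eq_iff)
  qed
  have A': "(A has_field_derivative - Polygamma 1 (1 - z) - Polygamma 1 (1 + z) -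
      (\<Sum>\<^sub>\<infinity>n\<in>- {0}. csc2_pi (z - of_int n * \<tau>))) (at z)" if "z \<in> ball 0 lattice_radius" for z
    unfolding A_def[abs_def] using s'[OF that] np[OF that] by (auto intro!: derivative_eq_intros)
  \<comment> \<open>The omitted term is \<open>csc2_pi 0 = 0\<close>. The two Polygamma values at 1
    then add up to the summand \<pi>^2 / 3 of \<open>G2\<close>.\<close>
  have "(\<Sum>\<^sub>\<infinity>n\<in>- {0}. csc2_pi (0 - of_int n * \<tau>)) = csc2_sum \<tau> 0"
    unfolding csc2_sum_def by (intro infsum_cong_neutral) (auto simp: csc2_pi_def)
  then have "deriv A 0 = - G2 \<tau>"
    using DERIV_imp_deriv[OF A'[of 0]] lattice_radius_pos by (simp add: G2_def Polygamma_1_1 del: One_nat_def)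
  have s_odd: "s (- z) = - s z" for z
  proof -
    have c: "c (- n) (- z) = - c n z" for n
      using cot_pi_minus[of "z - of_int n * \<tau>"] by (simp add: c_def)
    have "s (- z) = (\<Sum>\<^sub>\<infinity>n\<in>- {0}. c (- n) (- z))"
      unfolding s_def by (rule infsum_reindex_bij_witness[of _ uminus uminus]) auto
    then show ?thesis by (simp add: c s_def infsum_uminus)
  qed
  have "A holomorphic_on ball 0 lattice_radius"
    unfolding holomorphic_on_open[OF open_ball] using A' by blast
  moreover have "A (- z) = - A z" for z
    by (simp add: A_def s_odd)
  ultimately obtain k where k: "k holomorphic_on ball 0 lattice_radius"
    "\<And>z. z \<in> ball 0 lattice_radius \<Longrightarrow> A z = deriv A 0 * z + z ^ 3 * k z"
    using odd_holomorphic_factor[OF _ lattice_radius_pos] by metis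
  show ?thesis
  proof (rule that[OF k(1)])
    fix z :: complex assume z: "z \<in> ball 0 lattice_radius" "z \<noteq> 0"
    have "infsum (\<lambda>n. c n z) (insert 0 (- {0})) = c 0 z + s z"
      unfolding s_def by (rule infsum_insert[OF summ[OF z(1)]]) simp
    moreover have "insert 0 (- {0}) = (UNIV :: int set)" by auto
    ultimately have "cot_sum \<tau> z = c 0 z + s z" by (simp add: cot_sum_def c_def)
    also have "c 0 z = Digamma (1 - z) - Digamma z"
      using cot_pi_eq_Digamma[OF ball_lattice_radius_not_Int[OF z]] by (simp add: c_def)
    finally have "cot_sum \<tau> z = 1 / z + A z"
      using Digamma_plus1[OF z(2)] by (simp add: A_def add.commute)
    then show "cot_sum \<tau> z = 1 / z - G2 \<tau> * z + z ^ 3 * k z"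
      using k(2)[OF z(1)] \<open>deriv A 0 = - G2 \<tau>\<close> by simp
  qed
qed

text \<open>The coefficients are forced. Under z to z + \<tau> the product Z P' loses 2 \<pi> i P',
  which 2 \<pi> i Q' regains. At 0 the terms in 1/z^4 are -2 + 2 and those in 1/z^2 are 2C + 4C -
  6C, so the poles cancel; the remaining expansion is holomorphic because the Laurent series of Z
  has no further negative or even terms up to order 2.\<close>

lemma elliptic_identity:
  obtains K where "\<And>z. z \<notin> period_lattice \<tau> \<Longrightarrow>
    cot_sum \<tau> z * deriv (csc2_sum \<tau>) z + 2 * of_real pi * \<i> * deriv (csc2_sum_weighted \<tau>) z +
    2 * (csc2_sum \<tau> z)\<^sup>2 - 6 * G2 \<tau> * csc2_sum \<tau> z = K"
proof -
  let ?L = "period_lattice \<tau>"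
  define P Q Z C where "P = csc2_sum \<tau>" and "Q = csc2_sum_weighted \<tau>" and "Z = cot_sum \<tau>" and "C = G2 \<tau>"
  note folds = P_def[symmetric] Q_def[symmetric] Z_def[symmetric] C_def[symmetric]
  define F where "F z = Z z * deriv P z + 2 * of_real pi * \<i> * deriv Q z + 2 * (P z)\<^sup>2 - 6 * C * P z" for z
  have op: "open (- ?L)" by (rule open_Compl_period_lattice)
  note holo = holomorphic_on_csc2_sum holomorphic_on_csc2_sum_weighted holomorphic_on_cot_sum
  note holo = holo[unfolded folds]
  have Fholo: "F holomorphic_on - ?L"
    unfolding F_def by (intro holomorphic_intros holo op)
  have add: "z + w \<in> - ?L" if "z \<notin> ?L" "w \<in> ?L" for z w
    using period_lattice_add_iff[OF that(2), of z] that(1) by simp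
  have F1: "F (z + 1) = F z" if z: "z \<notin> ?L" for z
  proof -
    have "deriv P (z + 1) = deriv P z" "deriv Q (z + 1) = deriv Q z"
      using deriv_shift[OF holo(1) holomorphic_on_const op _ add[OF z one_in_period_lattice], of 0]
        deriv_shift[OF holo(2) holomorphic_on_const op _ add[OF z one_in_period_lattice], of 0] z
      by (auto simp: P_def Q_def csc2_sum_plus_1 csc2_sum_weighted_plus_1)
    then show ?thesis by (simp add: F_def P_def Z_def csc2_sum_plus_1 cot_sum_plus_1)
  qed
  have F\<tau>: "F (z + \<tau>) = F z" if z: "z \<notin> ?L" for z
  proof -
    have 1: "deriv P (z + \<tau>) = deriv P z"
      using deriv_shift[OF holo(1) holomorphic_on_const op _ add[OF z tau_in_period_lattice], of 0] z
      by (auto simp: P_def csc2_sum_plus_tau)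
    have 2: "deriv Q (z + \<tau>) = deriv Q z + deriv P z"
      using z by (intro deriv_shift[OF holo(2) holo(1) op _ add[OF z tau_in_period_lattice]])
        (auto simp: P_def Q_def csc2_sum_weighted_plus_tau)
    have 3: "Z (z + \<tau>) = Z z - 2 * of_real pi * \<i>"
      unfolding Z_def by (rule cot_sum_plus_tau[OF z])
    have 4: "P (z + \<tau>) = P z" unfolding P_def by (rule csc2_sum_plus_tau)
    show ?thesis unfolding F_def 1 2 3 4 by (simp add: algebra_simps)
  qed
  let ?B = "ball 0 lattice_radius :: complex set"
  obtain k where k: "k holomorphic_on ?B" "\<And>z. z \<in> ?B \<Longrightarrow> z \<noteq> 0 \<Longrightarrow> Z z = 1 / z - C * z + z ^ 3 * k z"
    using cot_sum_Laurent_expansion unfolding folds by blast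
  \<comment> \<open>Differentiation of \<open>z ^ 3 * k z\<close> gives
    \<open>z\<^sup>2 * l z\<close>, and differentiation of that gives \<open>z * m z\<close>; they
    are the regular remainders in P = - Z' and in P'.\<close>
  define l where "l z = 3 * k z + z * deriv k z" for z
  define m where "m z = 2 * l z + z * deriv l z" for z
  have l: "l holomorphic_on ?B" unfolding l_def by (intro holomorphic_intros k open_ball)
  have m: "m holomorphic_on ?B" unfolding m_def by (intro holomorphic_intros l open_ball)
  have opB: "open (?B - {0})" by (simp add: open_delete)
  have notL: "z \<notin> ?L" if "z \<in> ?B - {0}" for z using that ball_lattice_radius_Int by blast
  have P: "P z = 1 / z\<^sup>2 + C - z\<^sup>2 * l z" if z: "z \<in> ?B - {0}" for z
  proof -
    have k': "(k has_field_derivative deriv k z) (at z)"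
      using z by (intro holomorphic_derivI[OF k(1)]) auto
    have "((\<lambda>z. 1 / z - C * z + z ^ 3 * k z) has_field_derivative
        - (1 / z\<^sup>2) - C + (3 * z\<^sup>2 * k z + z ^ 3 * deriv k z)) (at z)"
      using z by (auto intro!: derivative_eq_intros k' simp: power2_eq_square)
    then have "(Z has_field_derivative - (1 / z\<^sup>2) - C + (3 * z\<^sup>2 * k z + z ^ 3 * deriv k z)) (at z)"
      by (rule has_field_derivative_transform_within_open[OF _ opB z]) (simp add: k(2))
    moreover have "(Z has_field_derivative - P z) (at z)"
      unfolding Z_def P_def by (rule has_field_derivative_cot_sum[OF notL[OF z]])
    ultimately have "- P z = - (1 / z\<^sup>2) - C + (3 * z\<^sup>2 * k z + z ^ 3 * deriv k z)"
      by (intro DERIV_unique)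
    then have "P z = - (- (1 / z\<^sup>2) - C + (3 * z\<^sup>2 * k z + z ^ 3 * deriv k z))" by (metis minus_minus)
    then show ?thesis by (simp add: l_def power2_eq_square power3_eq_cube algebra_simps)
  qed
  have P': "deriv P z = - 2 / z ^ 3 - z * m z" if z: "z \<in> ?B - {0}" for z
  proof -
    have l': "(l has_field_derivative deriv l z) (at z)"
      using z by (intro holomorphic_derivI[OF l]) auto
    have "((\<lambda>z. 1 / z\<^sup>2 + C - z\<^sup>2 * l z) has_field_derivative - 2 / z ^ 3 - z * m z) (at z)"
      using z by (auto intro!: derivative_eq_intros l' simp: m_def field_simps power2_eq_square power3_eq_cube)
    then have "(P has_field_derivative - 2 / z ^ 3 - z * m z) (at z)"
      by (rule has_field_derivative_transform_within_open[OF _ opB z]) (simp add: P)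
    then show ?thesis by (rule DERIV_imp_deriv)
  qed
  \<comment> \<open>The product expansion of \<open>F\<close> after cancelling the powers 1/z^4 and
    1/z^2; every term left is holomorphic at 0.\<close>
  define g where "g z = - m z + C * z\<^sup>2 * m z - 2 * k z - z ^ 4 * k z * m z - 4 * l z +
    2 * (C - z\<^sup>2 * l z)\<^sup>2 - 6 * C\<^sup>2 + 6 * C * z\<^sup>2 * l z + 2 * of_real pi * \<i> * deriv Q z" for z
  have g: "g holomorphic_on ?B"
    unfolding g_def using holomorphic_on_csc2_sum_weighted_ball
    by (intro holomorphic_intros k l m) (auto simp: Q_def)
  have Fg: "F z = g z" if z: "z \<in> ?B" "z \<noteq> 0" for z
  proof -
    have z': "z \<in> ?B - {0}" using z by auto
    \<comment> \<open>With \<open>x\<close> for the inverse, the comparison becomes a polynomial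
      identity modulo \<open>x * z = 1\<close>.\<close>
    define x where "x = 1 / z"
    have x: "x * z = 1" using z by (simp add: x_def)
    have "F z - g z = (x - C * z + z ^ 3 * k z) * (- 2 * x ^ 3 - z * m z) + 2 * (x\<^sup>2 + C - z\<^sup>2 * l z)\<^sup>2
       - 6 * C * (x\<^sup>2 + C - z\<^sup>2 * l z) - (- m z + C * z\<^sup>2 * m z - 2 * k z - z ^ 4 * k z * m z - 4 * l z +
    2 * (C - z\<^sup>2 * l z)\<^sup>2 - 6 * C\<^sup>2 + 6 * C * z\<^sup>2 * l z)"
      unfolding F_def g_def k(2)[OF z] P[OF z'] P'[OF z'] x_def by (simp add: power_divide)
    also have "\<dots> = 0" using x by algebra
    finally show ?thesis by simp
  qed
  obtain K where "\<And>z. z \<notin> ?L \<Longrightarrow> F z = K"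
    using elliptic_function_without_poles_constant[OF Im_tau Fholo F1 F\<tau> lattice_radius_pos
        ball_lattice_radius_Int g Fg] by blast
  then show ?thesis using that[of K] by (simp add: F_def P_def Q_def Z_def C_def)
qed

section \<open>Derivative and sum of the values at half periods\<close>

lemma deriv_csc2_sum_half_period:
  assumes \<omega>: "\<omega> \<notin> period_lattice \<tau>" and per: "\<And>z. csc2_sum \<tau> (2 * \<omega> - z) = csc2_sum \<tau> z"
  shows "deriv (csc2_sum \<tau>) \<omega> = 0"
proof -
  have "(csc2_sum \<tau> has_field_derivative deriv (csc2_sum \<tau>) \<omega>) (at (2 * \<omega> - \<omega>))"
    using has_field_derivative_csc2_sum[OF \<omega>] by simp
  \<comment> \<open>Reflection in \<omega> preserves the function and fixes \<omega>, but reverses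
    the sign of the derivative there.\<close>
  then have "((\<lambda>z. csc2_sum \<tau> (2 * \<omega> - z)) has_field_derivative deriv (csc2_sum \<tau>) \<omega> * (- 1)) (at \<omega>)"
    by (rule DERIV_chain2[where g = "\<lambda>z. 2 * \<omega> - z"]) (auto intro!: derivative_eq_intros)
  then have "(csc2_sum \<tau> has_field_derivative - deriv (csc2_sum \<tau>) \<omega>) (at \<omega>)" by (simp add: per)
  then have "deriv (csc2_sum \<tau>) \<omega> = - deriv (csc2_sum \<tau>) \<omega>" by (rule DERIV_imp_deriv)
  then show ?thesis by simp
qed

text \<open>The multiples of \<tau>/2 are summed together with their translates by 1/2. Even and odd
  multiples yield P at 0, 1/2, \<tau>/2 and 1/2 + \<tau>/2. Duplication evaluates the same sum as
  \<pi>^2 + 4 P(0), and \<pi>^2 + 3 P(0) is 3 \<open>G2\<close>. Here P(0) denotes the sum without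
  its singular term.\<close>

lemma csc2_sum_half_periods:
  assumes nL: "1 / 2 \<notin> period_lattice \<tau>" "\<tau> / 2 \<notin> period_lattice \<tau>" "1 / 2 + \<tau> / 2 \<notin> period_lattice \<tau>"
  shows "csc2_sum \<tau> (1 / 2) + csc2_sum \<tau> (1 / 2 + \<tau> / 2) + csc2_sum \<tau> (\<tau> / 2) = 3 * G2 \<tau>"
proof -
  define T where "T n = csc2_pi (of_int n * \<tau> / 2) + csc2_pi (of_int n * \<tau> / 2 + 1 / 2)" for n
  have P: "((\<lambda>n. csc2_pi (of_int n * \<tau> + z)) has_sum csc2_sum \<tau> z) UNIV" if "z \<notin> period_lattice \<tau>" for z
  proof -
    have "((\<lambda>n. csc2_pi (z - of_int (- n) * \<tau>)) has_sum csc2_sum \<tau> z) UNIV"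
      using has_sum_csc2_sum[OF that]
      by (subst has_sum_reindex_bij_betw[where g = uminus and B = UNIV and f = "\<lambda>n. csc2_pi (z - of_int n * \<tau>)"])
         (auto intro!: bij_betwI[of _ _ _ uminus])
    then show ?thesis by (simp add: add.commute)
  qed
  have P0: "((\<lambda>n. csc2_pi (of_int n * \<tau>)) has_sum csc2_sum \<tau> 0) UNIV"
    using has_sum_infsum[OF summable_csc2_sum_0] by (simp add: csc2_sum_def csc2_pi_minus)
  have "((\<lambda>m. T (2 * m)) has_sum (csc2_sum \<tau> 0 + csc2_sum \<tau> (1 / 2))) UNIV"
    using has_sum_add[OF P0 P[OF nL(1)]] by (simp add: T_def)
  moreover have "((\<lambda>m. T (2 * m + 1)) has_sum (csc2_sum \<tau> (\<tau> / 2) + csc2_sum \<tau> (1 / 2 + \<tau> / 2))) UNIV"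
    using has_sum_add[OF P[OF nL(2)] P[OF nL(3)]] by (simp add: T_def add_divide_distrib distrib_right add_ac)
  ultimately have 1: "(T has_sum (csc2_sum \<tau> 0 + csc2_sum \<tau> (1 / 2) +
      (csc2_sum \<tau> (\<tau> / 2) + csc2_sum \<tau> (1 / 2 + \<tau> / 2)))) UNIV"
    by (rule has_sum_int_even_odd)
  have T: "T n = (if n = 0 then of_real pi ^ 2 else 0) + 4 * csc2_pi (of_int n * \<tau>)" for n
  proof (cases "n = 0")
    case True
    have "sin (complex_of_real pi / 2) = 1" using sin_of_real[of "pi / 2"] by simp
    with True show ?thesis by (simp add: T_def csc2_pi_def)
  next
    case False
    have "of_int n * \<tau> \<notin> \<int>"
      using ball_lattice_radius_nonint[of 0 "- n"] False lattice_radius_pos by simp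
    then show ?thesis using csc2_pi_duplication[of "of_int n * \<tau> / 2"] False by (simp add: T_def)
  qed
  have "((\<lambda>n. (if n = 0 then of_real pi ^ 2 else 0) + 4 * csc2_pi (of_int n * \<tau>)) has_sum
      (of_real pi ^ 2 + 4 * csc2_sum \<tau> 0)) UNIV"
    by (intro has_sum_add has_sum_cmult_right P0 has_sum_finite_neutralI[of "{0}"]) auto
  then have 2: "(T has_sum (of_real pi ^ 2 + 4 * csc2_sum \<tau> 0)) UNIV" by (simp only: T cong: has_sum_cong)
  show ?thesis using has_sum_unique[OF 1 2] by (simp add: G2_def algebra_simps)
qed

end

section \<open>Half periods\<close>

lemma has_sum_diff_complex:
  fixes f g :: "'a \<Rightarrow> complex"
  assumes "(f has_sum a) A" "(g has_sum b) A"
  shows "((\<lambda>x. f x - g x) has_sum (a - b)) A"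
  using has_sum_add[OF assms(1) has_sum_uminusI[OF assms(2)]] by simp

context upper_half_plane
begin

lemma has_sum_inverse_squares_row:
  "((\<lambda>m. 1 / (of_int m + of_int n * \<tau>)\<^sup>2) has_sum
     ((if n = 0 then of_real (pi\<^sup>2 / 3) else 0) + csc2_pi (of_int n * \<tau>))) UNIV"
proof (cases "n = 0")
  case True
  then show ?thesis using inverse_squares_has_sum_int by (simp add: csc2_pi_def)
next
  case False
  have "- (of_int n * \<tau>) \<notin> \<int>"
    using ball_lattice_radius_nonint[of 0 n] False lattice_radius_pos by simp
  moreover have "(- (of_int n * \<tau>) - of_int m)\<^sup>2 = (of_int m + of_int n * \<tau>)\<^sup>2" for m
    by (simp add: power2_eq_square algebra_simps)
  ultimately show ?thesis
    using has_sum_csc2_pi[of "- (of_int n * \<tau>)"] False by (simp add: csc2_pi_minus)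
qed

text \<open>With the row sums found before, this identifies \<open>G2\<close> as the Eisenstein
  series of weight two summed along rows first; the double series itself is not absolutely
  convergent.\<close>

lemma has_sum_G2:
  "((\<lambda>n::int. (if n = 0 then of_real (pi\<^sup>2 / 3) else 0) + csc2_pi (of_int n * \<tau>)) has_sum G2 \<tau>) UNIV"
  unfolding G2_def
proof (intro has_sum_add)
  show "((\<lambda>n::int. if n = 0 then complex_of_real (pi\<^sup>2 / 3) else 0) has_sum of_real (pi\<^sup>2 / 3)) UNIV"
    by (rule has_sum_finite_neutralI[of "{0}"]) auto
  show "((\<lambda>n. csc2_pi (of_int n * \<tau>)) has_sum csc2_sum \<tau> 0) UNIV"
    using has_sum_infsum[OF summable_csc2_sum_0] by (simp add: csc2_sum_def csc2_pi_minus)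
qed

section \<open>The Weierstrass series summed over rows\<close>

lemma real_combination_in_period_lattice_iff:
  "of_real \<alpha> + of_real \<beta> * \<tau> \<in> period_lattice \<tau> \<longleftrightarrow> \<alpha> \<in> \<int> \<and> \<beta> \<in> \<int>"
proof
  assume "of_real \<alpha> + of_real \<beta> * \<tau> \<in> period_lattice \<tau>"
  then obtain m n where mn: "of_real \<alpha> + of_real \<beta> * \<tau> = of_int m + of_int n * \<tau>"
    by (auto simp: period_lattice_def)
  have "\<beta> = of_int n" using arg_cong[OF mn, of Im] Im_tau by simp
  moreover from this have "\<alpha> = of_int m" using arg_cong[OF mn, of Re] by simp
  ultimately show "\<alpha> \<in> \<int> \<and> \<beta> \<in> \<int>" by simp
next
  assume "\<alpha> \<in> \<int> \<and> \<beta> \<in> \<int>"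
  then obtain m n where "\<alpha> = of_int m" "\<beta> = of_int n" by (auto elim!: Ints_cases)
  then show "of_real \<alpha> + of_real \<beta> * \<tau> \<in> period_lattice \<tau>"
    by (auto simp: period_lattice_def)
qed

text \<open>A coordinate of modulus at most 1/2 stays at distance at least \<bar>n\<bar>/2 from
  every integer n, so subtracting a lattice point from z costs at most a factor 2 in the lower bound
  for the norm.\<close>

lemma half_period_lattice_bounds:
  fixes \<alpha> \<beta> :: real
  assumes "\<bar>\<alpha>\<bar> \<le> 1 / 2" "\<bar>\<beta>\<bar> \<le> 1 / 2"
  obtains k where "k > 0"
    "\<And>x y r w. r = \<bar>of_int x\<bar> + \<bar>of_int y\<bar> \<Longrightarrow> w = of_int x + of_int y * \<tau> \<Longrightarrow>
      k * r \<le> norm w \<and> norm w \<le> (1 + norm \<tau>) * r \<and> k * r / 2 \<le> norm (of_real \<alpha> + of_real \<beta> * \<tau> - w)"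
proof -
  obtain k where k: "k > 0" "\<And>x y. cmod (of_real x + of_real y * \<tau>) \<ge> k * (\<bar>x\<bar> + \<bar>y\<bar>)"
    using cmod_real_plus_real_times_ge[OF Im_tau] by blast
  show ?thesis
  proof (rule that[OF k(1)], intro conjI)
    fix x y :: int and r w assume r: "r = \<bar>real_of_int x\<bar> + \<bar>real_of_int y\<bar>" and w: "w = of_int x + of_int y * \<tau>"
    show "k * r \<le> norm w" using k(2)[of "of_int x" "of_int y"] by (simp add: r w)
    have "norm w \<le> \<bar>of_int x\<bar> + \<bar>of_int y\<bar> * norm \<tau>"
      unfolding w by (rule order_trans[OF norm_triangle_ineq]) (simp add: norm_mult)
    also have "\<dots> \<le> (1 + norm \<tau>) * r"
      by (simp add: r algebra_simps)
    finally show "norm w \<le> (1 + norm \<tau>) * r" .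
    have half: "\<bar>of_int n\<bar> / 2 \<le> \<bar>\<gamma> - of_int n\<bar>" if "\<bar>\<gamma>\<bar> \<le> 1 / 2" for \<gamma> :: real and n :: int
    proof (cases "n = 0")
      case False
      then have "\<bar>real_of_int n\<bar> \<ge> 1" by linarith
      with that show ?thesis by linarith
    qed simp
    have "r / 2 \<le> \<bar>\<alpha> - of_int x\<bar> + \<bar>\<beta> - of_int y\<bar>"
      unfolding r add_divide_distrib by (intro add_mono half assms)
    then have "k * r / 2 \<le> k * (\<bar>\<alpha> - of_int x\<bar> + \<bar>\<beta> - of_int y\<bar>)"
      using mult_left_mono[of "r / 2" _ k] k(1) by simp
    also have "\<dots> \<le> norm (of_real \<alpha> + of_real \<beta> * \<tau> - w)"
      using k(2)[of "\<alpha> - of_int x" "\<beta> - of_int y"] by (simp add: w algebra_simps)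
    finally show "k * r / 2 \<le> norm (of_real \<alpha> + of_real \<beta> * \<tau> - w)" .
  qed
qed

text \<open>The summand equals z (2w - z) / (w^2 (z - w)^2), of cubic decay, so the series may be
  summed by rows. Within a row both inverse squares converge separately and have known sums.\<close>

lemma weierstrass_wp_eq_csc2_sum:
  fixes \<alpha> \<beta> :: real
  assumes "\<bar>\<alpha>\<bar> \<le> 1 / 2" "\<bar>\<beta>\<bar> \<le> 1 / 2" and z: "z = of_real \<alpha> + of_real \<beta> * \<tau>" "z \<notin> period_lattice \<tau>"
  shows "weierstrass_wp \<tau> z = csc2_sum \<tau> z - G2 \<tau>"
proof -
  \<comment> \<open>Since \<open>1 / 0 = 0\<close>, the separate term \<open>1 / z\<^sup>2\<close> of \<open>\<wp>\<close> is \<open>f 0\<close>.\<close>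
  define f where "f w = 1 / (z - w)\<^sup>2 - 1 / w\<^sup>2" for w
  obtain k where k: "k > 0"
    "\<And>x y r w. r = \<bar>of_int x\<bar> + \<bar>of_int y\<bar> \<Longrightarrow> w = of_int x + of_int y * \<tau> \<Longrightarrow>
      k * r \<le> norm w \<and> norm w \<le> (1 + norm \<tau>) * r \<and> k * r / 2 \<le> norm (z - w)"
    using half_period_lattice_bounds[OF assms(1,2)] unfolding z(1) by blast
  \<comment> \<open>Chosen so that the numerator is at most \<open>B * r\<close>, using that
    \<open>r\<close> is at least 1 off the origin.\<close>
  define B where "B = norm z * (2 * (1 + norm \<tau>) + norm z)"
  have "norm (f (of_int x + of_int y * \<tau>)) \<le> (4 * B / k ^ 4) / (\<bar>real_of_int x\<bar> + \<bar>real_of_int y\<bar>) ^ 3"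
    if xy: "(x, y) \<noteq> (0, 0)" for x y
  proof -
    define r where "r = \<bar>real_of_int x\<bar> + \<bar>real_of_int y\<bar>"
    define w where "w = of_int x + of_int y * \<tau>"
    have r: "r \<ge> 1" using xy unfolding r_def by (cases "x = 0") auto
    have b: "k * r \<le> norm w" "norm w \<le> (1 + norm \<tau>) * r" "k * r / 2 \<le> norm (z - w)"
      using k(2)[OF r_def w_def] by auto
    have pos: "0 < k * r" using k(1) r by simp
    have nz: "w \<noteq> 0" "z - w \<noteq> 0" using b pos by auto
    then have "f w = z * (2 * w - z) / (w\<^sup>2 * (z - w)\<^sup>2)"
      by (simp add: f_def divide_simps) (simp add: power2_eq_square algebra_simps)
    then have "norm (f w) = norm z * norm (2 * w - z) / ((norm w)\<^sup>2 * (norm (z - w))\<^sup>2)"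
      by (simp add: norm_mult norm_divide norm_power)
    also have "\<dots> \<le> (B * r) / ((k * r)\<^sup>2 * (k * r / 2)\<^sup>2)"
    proof (rule frac_le)
      have "norm (2 * w - z) \<le> 2 * norm w + norm z"
        using norm_triangle_ineq4[of "2 * w" z] by (simp add: norm_mult)
      also have "\<dots> \<le> 2 * ((1 + norm \<tau>) * r) + norm z * r"
        using b(2) r by (intro add_mono mult_left_mono) (auto simp: mult_le_cancel_left1)
      finally have "norm z * norm (2 * w - z) \<le> norm z * (2 * ((1 + norm \<tau>) * r) + norm z * r)"
        by (intro mult_left_mono) auto
      also have "\<dots> = B * r" by (simp add: B_def algebra_simps)
      finally show "norm z * norm (2 * w - z) \<le> B * r" .
      show "(k * r)\<^sup>2 * (k * r / 2)\<^sup>2 \<le> (norm w)\<^sup>2 * (norm (z - w))\<^sup>2"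
        using b pos by (intro mult_mono power_mono) auto
      show "0 < (k * r)\<^sup>2 * (k * r / 2)\<^sup>2"
        using k(1) r by (intro mult_pos_pos zero_less_power) auto
    qed (use r in \<open>auto simp: B_def\<close>)
    also have "\<dots> = (4 * B / k ^ 4) / r ^ 3"
      using k(1) r by (simp add: field_simps power2_eq_square power3_eq_cube power4_eq_xxxx)
    finally show ?thesis by (simp add: r_def w_def)
  qed
  from infsum_period_lattice[OF Im_tau, of f, OF this]
  have "weierstrass_wp \<tau> z = (\<Sum>\<^sub>\<infinity>n. \<Sum>\<^sub>\<infinity>m. f (of_int m + of_int n * \<tau>))"
    by (simp add: weierstrass_wp_def f_def)
  also have "\<dots> = (\<Sum>\<^sub>\<infinity>n::int. csc2_pi (z - of_int n * \<tau>) -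
      ((if n = 0 then of_real (pi\<^sup>2 / 3) else 0) + csc2_pi (of_int n * \<tau>)))"
  proof (intro infsum_cong infsumI)
    fix n :: int
    have "((\<lambda>m. 1 / (z - of_int n * \<tau> - of_int m)\<^sup>2) has_sum csc2_pi (z - of_int n * \<tau>)) UNIV"
      by (rule has_sum_csc2_pi[OF not_in_period_latticeD[OF z(2)]])
    from has_sum_diff_complex[OF this has_sum_inverse_squares_row[of n]]
    show "((\<lambda>m. f (of_int m + of_int n * \<tau>)) has_sum (csc2_pi (z - of_int n * \<tau>) -
      ((if n = 0 then of_real (pi\<^sup>2 / 3) else 0) + csc2_pi (of_int n * \<tau>)))) UNIV"
      by (simp add: f_def diff_diff_eq add.commute)
  qed
  also have "\<dots> = csc2_sum \<tau> z - G2 \<tau>"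
    by (intro infsumI has_sum_diff_complex has_sum_csc2_sum[OF z(2)] has_sum_G2)
  finally show ?thesis .
qed

text \<open>The summand is z^2 / ((z - w) w^2), of cubic decay. Adding its values at w and -w
  cancels 1/w and turns z/w^2 into 2z/w^2 = 1/w^2, because z = 1/2. The two remaining fractions
  telescope along a row, whose step is 1 = 2z. Hence twice the series is the Eisenstein
  series.\<close>

lemma weierstrass_eta1_eq_G2: "weierstrass_eta1 \<tau> = G2 \<tau> / 2"
proof -
  define z :: complex where "z = 1 / 2"
  define f where "f w = 1 / (z - w) + 1 / w + z / w\<^sup>2" for w
  obtain k where k: "k > 0"
    "\<And>x y r w. r = \<bar>of_int x\<bar> + \<bar>of_int y\<bar> \<Longrightarrow> w = of_int x + of_int y * \<tau> \<Longrightarrow>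
      k * r \<le> norm w \<and> norm w \<le> (1 + norm \<tau>) * r \<and> k * r / 2 \<le> norm (of_real (1/2) + of_real 0 * \<tau> - w)"
    using half_period_lattice_bounds[of "1 / 2" 0] by auto
  have bound: "norm (f (of_int x + of_int y * \<tau>)) \<le> (2 * (norm z)\<^sup>2 / k ^ 3) / (\<bar>real_of_int x\<bar> + \<bar>real_of_int y\<bar>) ^ 3"
    if xy: "(x, y) \<noteq> (0, 0)" for x y
  proof -
    define r where "r = \<bar>real_of_int x\<bar> + \<bar>real_of_int y\<bar>"
    define w where "w = of_int x + of_int y * \<tau>"
    have r: "r \<ge> 1" using xy unfolding r_def by (cases "x = 0") auto
    have b: "k * r \<le> norm w" "k * r / 2 \<le> norm (z - w)"
      using k(2)[OF r_def w_def] by (auto simp: z_def)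
    have pos: "0 < k * r" using k(1) r by simp
    have nz: "w \<noteq> 0" "z - w \<noteq> 0" using b pos by auto
    then have "f w = z\<^sup>2 / ((z - w) * w\<^sup>2)"
      by (simp add: f_def divide_simps) (simp add: power2_eq_square algebra_simps)
    then have "norm (f w) = (norm z)\<^sup>2 / (norm (z - w) * (norm w)\<^sup>2)"
      by (simp add: norm_mult norm_divide norm_power)
    also have "\<dots> \<le> (norm z)\<^sup>2 / ((k * r / 2) * (k * r)\<^sup>2)"
    proof (rule frac_le)
      show "0 < k * r / 2 * (k * r)\<^sup>2"
        using k(1) r by (intro mult_pos_pos zero_less_power) auto
      show "k * r / 2 * (k * r)\<^sup>2 \<le> norm (z - w) * (norm w)\<^sup>2"
        using b pos by (intro mult_mono power_mono) auto
    qed auto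
    also have "\<dots> = (2 * (norm z)\<^sup>2 / k ^ 3) / r ^ 3"
      using k(1) r by (simp add: field_simps power2_eq_square power3_eq_cube)
    finally show ?thesis by (simp add: r_def w_def)
  qed
  define F where "F n m = f (of_int m + of_int n * \<tau>)" for n m :: int
  have summ: "(\<lambda>(n, m). F n m) summable_on UNIV \<times> UNIV"
    unfolding F_def by (rule summable_on_period_lattice[OF Im_tau bound])
  have rows: "F n summable_on UNIV" for n
    using summable_on_SigmaD1[OF summ, of n] by simp
  have cols: "(\<lambda>n. infsum (F n) UNIV) summable_on UNIV"
    using summable_on_Sigma_banach[OF summ] by simp
  have eta: "weierstrass_eta1 \<tau> = (\<Sum>\<^sub>\<infinity>n. infsum (F n) UNIV)"
  proof -
    have "weierstrass_eta1 \<tau> = f 0 + (\<Sum>\<^sub>\<infinity>w\<in>period_lattice \<tau> - {0}. f w)"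
      by (simp add: weierstrass_eta1_def half_period_def weierstrass_zeta_def f_def z_def)
    also have "\<dots> = (\<Sum>\<^sub>\<infinity>n. infsum (F n) UNIV)"
      unfolding F_def by (rule infsum_period_lattice[OF Im_tau bound])
    finally show ?thesis .
  qed
  have pair: "infsum (F n) UNIV + infsum (F (- n)) UNIV =
      (if n = 0 then of_real (pi\<^sup>2 / 3) else 0) + csc2_pi (of_int n * \<tau>)" for n
  proof -
    define v where "v m = 1 / (1 / 2 + of_int m + of_int n * \<tau>)" for m :: int
    have neg: "(\<lambda>m. F (- n) (- m)) summable_on UNIV"
      using rows[of "- n"] by (subst summable_on_reindex_bij_betw[of uminus UNIV UNIV "F (- n)"])
        (auto intro!: bij_betwI[of _ _ _ uminus])
    \<comment> \<open>Pairing \<open>w\<close> with \<open>-w\<close> makes the part without \<open>1 / w\<^sup>2\<close> telescope along the row.\<close>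
    have eq: "F n m + F (- n) (- m) = (v m - v (m - 1)) + 1 / (of_int m + of_int n * \<tau>)\<^sup>2" for m
    proof -
      let ?w = "of_int m + of_int n * \<tau>"
      have "F (- n) (- m) = f (- ?w)" by (simp add: F_def algebra_simps)
      moreover have "f ?w + f (- ?w) = 1 / (z - ?w) + 1 / (z + ?w) + 1 / ?w\<^sup>2"
        unfolding f_def z_def by (simp only: divide_minus_right power2_minus diff_minus_eq_add) simp
      moreover have "v (m - 1) = - (1 / (z - ?w))" "v m = 1 / (z + ?w)"
        by (simp_all add: v_def z_def divide_simps) (simp_all add: algebra_simps)
      ultimately show ?thesis by (simp only: F_def) simp
    qed
    have sum_F: "((\<lambda>m. F n m + F (- n) (- m)) has_sum (infsum (F n) UNIV + infsum (F (- n)) UNIV)) UNIV"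
      using has_sum_infsum[OF neg] rows[of n] infsum_int_minus[of "F (- n)"]
      by (intro has_sum_add) auto
    from has_sum_diff_complex[OF this has_sum_inverse_squares_row[of n]]
    have tel: "((\<lambda>m. v m - v (m - 1)) has_sum (infsum (F n) UNIV + infsum (F (- n)) UNIV -
        ((if n = 0 then of_real (pi\<^sup>2 / 3) else 0) + csc2_pi (of_int n * \<tau>)))) UNIV"
      by (simp add: eq)
    have "(\<Sum>\<^sub>\<infinity>m. v m - v (m - 1)) = 0"
    proof (rule infsum_int_telescope)
      show "(\<lambda>m. v m - v (m - 1)) summable_on UNIV" using tel by (rule has_sum_imp_summable)
      have inf: "filterlim (\<lambda>N. of_int (int N) :: complex) at_infinity sequentially"
        using tendsto_of_nat[where 'a = complex] by simp
      have inf': "filterlim (\<lambda>N. of_int (- int N) :: complex) at_infinity sequentially"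
        using inf by (subst filterlim_at_infinity_conv_norm_at_top)
          (simp add: filterlim_at_infinity_conv_norm_at_top)
      \<comment> \<open>Both ends of the row recede to infinity, so the boundary terms of the
        telescoping sum vanish.\<close>
      have lim: "(\<lambda>N. v (h N)) \<longlonglongrightarrow> 0" if "filterlim (\<lambda>N. of_int (h N) :: complex) at_infinity sequentially" for h
      proof -
        have "filterlim (\<lambda>N. (1 / 2 + of_int n * \<tau>) + of_int (h N)) at_infinity sequentially"
          by (rule tendsto_add_filterlim_at_infinity[OF tendsto_const that])
        from tendsto_divide_0[OF tendsto_const this, of 1] show ?thesis
          by (simp add: v_def add_ac)
      qed
      show "(\<lambda>N. v (int N)) \<longlonglongrightarrow> 0" "(\<lambda>N. v (- int N)) \<longlonglongrightarrow> 0" by (rule lim, fact)+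
    qed
    with infsumI[OF tel] show ?thesis by simp
  qed
  \<comment> \<open>As n runs over all integers, rows n and -n together count each row
    twice.\<close>
  have "((\<lambda>n. infsum (F n) UNIV + infsum (F (- n)) UNIV) has_sum (weierstrass_eta1 \<tau> + weierstrass_eta1 \<tau>)) UNIV"
  proof (rule has_sum_add)
    show s: "((\<lambda>n. infsum (F n) UNIV) has_sum weierstrass_eta1 \<tau>) UNIV"
      unfolding eta by (rule has_sum_infsum[OF cols])
    then show "((\<lambda>n. infsum (F (- n)) UNIV) has_sum weierstrass_eta1 \<tau>) UNIV"
      by (subst has_sum_reindex_bij_betw[of uminus UNIV UNIV "\<lambda>n. infsum (F n) UNIV"])
        (auto intro!: bij_betwI[of _ _ _ uminus])
  qed
  then have "weierstrass_eta1 \<tau> + weierstrass_eta1 \<tau> = G2 \<tau>"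
    unfolding pair using has_sum_G2 by (rule has_sum_unique)
  then show ?thesis by (simp add: field_simps)
qed

section \<open>Half periods as functions of \<tau>\<close>

lemma half_period_cases:
  assumes "i \<in> {1, 2, 3}"
  obtains \<alpha> \<beta> :: real where "\<And>t. half_period i t = of_real \<alpha> + of_real \<beta> * t"
    "\<bar>\<alpha>\<bar> \<le> 1 / 2" "\<bar>\<beta>\<bar> \<le> 1 / 2" "\<beta> \<noteq> 0 \<or> \<alpha> \<notin> \<int>" "half_period i \<tau> \<notin> period_lattice \<tau>"
proof -
  have n: "(1 / 2 :: real) \<notin> \<int>" "- (1 / 2 :: real) \<notin> \<int>"
    using fraction_not_in_Ints[of 2 1, where 'a = real] by auto
  consider "i = 1" | "i = 2" | "i = 3" using assms by auto
  then show ?thesis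
  proof cases
    case 1
    then show ?thesis
      using n real_combination_in_period_lattice_iff[of "1/2" 0]
      by (intro that[of "1/2" 0]) (auto simp: half_period_def)
  next
    case 2
    then show ?thesis
      using n real_combination_in_period_lattice_iff[of "-1/2" "-1/2"]
      by (intro that[of "-1/2" "-1/2"]) (auto simp: half_period_def)
  next
    case 3
    then show ?thesis
      using n real_combination_in_period_lattice_iff[of 0 "1/2"]
      by (intro that[of 0 "1/2"]) (auto simp: half_period_def)
  qed
qed

lemma weierstrass_e_eq_csc2_sum:
  assumes "i \<in> {1, 2, 3}"
  shows "weierstrass_e i \<tau> = csc2_sum \<tau> (half_period i \<tau>) - G2 \<tau>"
  using half_period_cases[OF assms] weierstrass_wp_eq_csc2_sum unfolding weierstrass_e_def by metis

lemma sum_csc2_sum_half_period: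
  "csc2_sum \<tau> (half_period 1 \<tau>) + csc2_sum \<tau> (half_period 2 \<tau>) + csc2_sum \<tau> (half_period 3 \<tau>) = 3 * G2 \<tau>"
proof -
  have n: "(1 / 2 :: real) \<notin> \<int>"
    using fraction_not_in_Ints[of 2 1, where 'a = real] by auto
  have "csc2_sum \<tau> (half_period 2 \<tau>) = csc2_sum \<tau> (1 / 2 + \<tau> / 2)"
    using csc2_sum_minus[of \<tau> "1 / 2 + \<tau> / 2"] by (simp add: half_period_def)
  moreover have "1 / 2 \<notin> period_lattice \<tau>" "\<tau> / 2 \<notin> period_lattice \<tau>" "1 / 2 + \<tau> / 2 \<notin> period_lattice \<tau>"
    using n real_combination_in_period_lattice_iff[of "1/2" 0]
      real_combination_in_period_lattice_iff[of 0 "1/2"] real_combination_in_period_lattice_iff[of "1/2" "1/2"]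
    by auto
  ultimately show ?thesis
    using csc2_sum_half_periods by (simp add: half_period_def)
qed

text \<open>The total derivative is \<beta> P' - Q' at the moving point, where \<beta> is its
  coordinate along \<tau>, and P' vanishes at a half period by reflection.\<close>

lemma has_field_derivative_csc2_sum_at_half_period:
  assumes i: "i \<in> {1, 2, 3}"
  shows "((\<lambda>t. csc2_sum t (half_period i t)) has_field_derivative
           - deriv (csc2_sum_weighted \<tau>) (half_period i \<tau>)) (at \<tau>)"
    and "deriv (csc2_sum \<tau>) (half_period i \<tau>) = 0"
proof -
  let ?\<omega> = "half_period i \<tau>"
  obtain \<alpha> \<beta> :: real where h: "\<And>t. half_period i t = of_real \<alpha> + of_real \<beta> * t"
    "\<bar>\<beta>\<bar> \<le> 1 / 2" "\<beta> \<noteq> 0 \<or> \<alpha> \<notin> \<int>" and nL: "?\<omega> \<notin> period_lattice \<tau>"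
    using half_period_cases[OF i] by metis
  have "csc2_sum \<tau> (2 * ?\<omega> - z) = csc2_sum \<tau> z" for z
  proof -
    \<comment> \<open>Twice the half period is 1, -1 - \<tau> or \<tau>, so evenness and the two
      periods give the reflection symmetry.\<close>
    consider "2 * ?\<omega> - z = - z + 1" | "2 * ?\<omega> - z = - (z + 1 + \<tau>)" | "2 * ?\<omega> - z = - z + \<tau>"
      using i by (auto simp: half_period_def algebra_simps)
    then show ?thesis
      by cases (simp_all only: csc2_sum_minus csc2_sum_plus_1 csc2_sum_plus_tau)
  qed
  then show P0: "deriv (csc2_sum \<tau>) ?\<omega> = 0" by (rule deriv_csc2_sum_half_period[OF nL])
  obtain D where D: "((\<lambda>t. csc2_sum t (of_real \<alpha> + of_real \<beta> * t)) has_field_derivative D) (at \<tau>)"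
    "((\<lambda>n. (of_real \<beta> - of_int n) * deriv csc2_pi (of_real \<alpha> + of_real \<beta> * \<tau> - of_int n * \<tau>)) has_sum D) UNIV"
    using has_field_derivative_csc2_sum_half_period[OF Im_tau h(2,3)] by blast
  have "((\<lambda>n. of_real \<beta> * deriv csc2_pi (?\<omega> - of_int n * \<tau>) - of_int n * deriv csc2_pi (?\<omega> - of_int n * \<tau>)) has_sum
      (of_real \<beta> * deriv (csc2_sum \<tau>) ?\<omega> - deriv (csc2_sum_weighted \<tau>) ?\<omega>)) UNIV"
    by (intro has_sum_diff_complex has_sum_cmult_right has_sum_deriv_csc2_sum has_sum_deriv_csc2_sum_weighted nL)
  moreover have "((\<lambda>n. of_real \<beta> * deriv csc2_pi (?\<omega> - of_int n * \<tau>) - of_int n * deriv csc2_pi (?\<omega> - of_int n * \<tau>)) has_sum D) UNIV"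
    using D(2) by (simp add: h(1) left_diff_distrib)
  ultimately have "D = of_real \<beta> * deriv (csc2_sum \<tau>) ?\<omega> - deriv (csc2_sum_weighted \<tau>) ?\<omega>"
    by (rule has_sum_unique[rotated])
  with D(1) show "((\<lambda>t. csc2_sum t (half_period i t)) has_field_derivative
      - deriv (csc2_sum_weighted \<tau>) ?\<omega>) (at \<tau>)"
    by (simp add: h(1)[abs_def] P0[unfolded h(1)])
qed

end

section \<open>The differential equation\<close>

theorem propositionA2:
  fixes \<tau> :: complex and i :: nat
  assumes "Im \<tau> > 0"
    and "i \<in> {1, 2, 3}"
  shows "(weierstrass_e i has_field_derivative
           (- 2 * weierstrass_eta1 \<tau> * weierstrass_e i \<tau> + (weierstrass_e i \<tau>)\<^sup>2
              - weierstrass_g2 \<tau> / 6) / (complex_of_real pi * \<i>)) (at \<tau>)"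
proof -
  interpret upper_half_plane \<tau> by unfold_locales (rule assms(1))
  define p where "p = 2 * complex_of_real pi * \<i>"
  have p: "p \<noteq> 0" by (simp add: p_def)
  define E where "E j t = csc2_sum t (half_period j t)" for j t
  define C where "C = G2 \<tau>"
  obtain K where K: "\<And>z. z \<notin> period_lattice \<tau> \<Longrightarrow>
    cot_sum \<tau> z * deriv (csc2_sum \<tau>) z + 2 * of_real pi * \<i> * deriv (csc2_sum_weighted \<tau>) z +
    2 * (csc2_sum \<tau> z)\<^sup>2 - 6 * G2 \<tau> * csc2_sum \<tau> z = K"
    using elliptic_identity by blast
  \<comment> \<open>At a half period the elliptic identity loses its term Z P', so - 2 \<pi> i Q'
    equals \<open>N j\<close>, with the same unknown constant \<open>K\<close> for all three
    j.\<close>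
  define N where "N j = 2 * (E j \<tau>)\<^sup>2 - 6 * C * E j \<tau> - K" for j
  have E': "(E j has_field_derivative N j / p) (at \<tau>)" if j: "j \<in> {1, 2, 3}" for j
  proof -
    have "half_period j \<tau> \<notin> period_lattice \<tau>" using half_period_cases[OF j] by metis
    from K[OF this] have "p * deriv (csc2_sum_weighted \<tau>) (half_period j \<tau>) = - N j"
      using has_field_derivative_csc2_sum_at_half_period(2)[OF j]
      by (simp add: p_def N_def E_def C_def algebra_simps)
    then have "- deriv (csc2_sum_weighted \<tau>) (half_period j \<tau>) = N j / p"
      using p by (simp add: field_simps)
    then show ?thesis
      using has_field_derivative_csc2_sum_at_half_period(1)[OF j] by (simp add: E_def[abs_def])
  qed
  \<comment> \<open>Writing \<open>G2\<close> as the mean of the three values makes its derivative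
    available as well. The formula is proved throughout the upper half plane because it is about to
    be differentiated.\<close>
  have e: "weierstrass_e j t = E j t - (E 1 t + E 2 t + E 3 t) / 3"
    and sumE: "E 1 t + E 2 t + E 3 t = 3 * G2 t" if "Im t > 0" "j \<in> {1, 2, 3}" for j t
  proof -
    interpret t: upper_half_plane t by unfold_locales (rule that(1))
    show s: "E 1 t + E 2 t + E 3 t = 3 * G2 t"
      using t.sum_csc2_sum_half_period by (simp add: E_def)
    show "weierstrass_e j t = E j t - (E 1 t + E 2 t + E 3 t) / 3"
      unfolding s using t.weierstrass_e_eq_csc2_sum[OF that(2)] by (simp add: E_def)
  qed
  have "((\<lambda>t. E i t - (E 1 t + E 2 t + E 3 t) / 3) has_field_derivative
      N i / p - (N 1 / p + N 2 / p + N 3 / p) / 3) (at \<tau>)"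
    using assms(2) by (intro DERIV_diff DERIV_cdivide DERIV_add E') auto
  then have "(weierstrass_e i has_field_derivative
      N i / p - (N 1 / p + N 2 / p + N 3 / p) / 3) (at \<tau>)"
    by (rule has_field_derivative_transform_within_open[where S = "{t. Im t > 0}"])
       (use assms e in \<open>auto simp: open_halfspace_Im_gt\<close>)
  moreover have "N i / p - (N 1 / p + N 2 / p + N 3 / p) / 3 =
      (- 2 * weierstrass_eta1 \<tau> * weierstrass_e i \<tau> + (weierstrass_e i \<tau>)\<^sup>2
              - weierstrass_g2 \<tau> / 6) / (complex_of_real pi * \<i>)"
  proof -
    have s: "E 1 \<tau> + E 2 \<tau> + E 3 \<tau> = 3 * C"
      using sumE[OF assms] by (simp add: C_def)
    then have E3: "E 3 \<tau> = 3 * C - E 1 \<tau> - E 2 \<tau>" by (simp add: algebra_simps)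
    have e': "weierstrass_e j \<tau> = E j \<tau> - C" if "j \<in> {1, 2, 3}" for j
      using e[OF assms(1) that] s by simp
    \<comment> \<open>\<open>K\<close> cancels. In terms of e = E - C, each N is 2 e^2 - 2 C e plus
      a constant independent of j; since the three e add to 0, the sum of their squares is -2 times
      their second elementary symmetric function, which becomes the \<open>g2\<close> term.\<close>
    have "3 * N i - (N 1 + N 2 + N 3) = 6 * (- C * (E i \<tau> - C) + (E i \<tau> - C)\<^sup>2) +
      4 * ((E 1 \<tau> - C) * (E 2 \<tau> - C) + (E 2 \<tau> - C) * (E 3 \<tau> - C) + (E 3 \<tau> - C) * (E 1 \<tau> - C))"
      unfolding N_def E3 by (simp add: algebra_simps power2_eq_square)
    also have "\<dots> = 6 * (- 2 * weierstrass_eta1 \<tau> * weierstrass_e i \<tau> + (weierstrass_e i \<tau>)\<^sup>2 - weierstrass_g2 \<tau> / 6)"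
      using assms(2) by (simp add: weierstrass_g2_def e' weierstrass_eta1_eq_G2 C_def) (simp add: field_simps)
    finally have "3 * N i - (N 1 + N 2 + N 3) =
      6 * (- 2 * weierstrass_eta1 \<tau> * weierstrass_e i \<tau> + (weierstrass_e i \<tau>)\<^sup>2 - weierstrass_g2 \<tau> / 6)" .
    moreover have "N i / p - (N 1 / p + N 2 / p + N 3 / p) / 3 = (3 * N i - (N 1 + N 2 + N 3)) / (3 * p)"
      using p by (simp add: field_simps)
    moreover have "6 * X / (3 * p) = X / (complex_of_real pi * \<i>)" for X
      by (simp add: p_def)
    ultimately show ?thesis by (simp only:)
  qed
  ultimately show ?thesis by (simp only:)
qed

end
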